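(* Let $(\mathcal S,\mathcal A,H,P,R,\mu)$ be an episodic tabular MDP as described in the context, with non-negative rewards of expectations $r$. 1. (Worst-case distributions.) $$CR^H(P,r)=\max_{\pi\in\Pi^{\mathcal M}}\frac{\sum_{(h,s,a)\in\mathcal X}d_h^{\pi}(s,a)\,r_h(s,a)}{\sum_{(h,s,a)\in\mathcal X}d_h^*(s)\,r_h(s,a)}.$$ 2. (Worst-case reward expectations.) $$CR^H(P)=\max_{\pi\in\Pi^{\mathcal M}}\min_{(h,s,a)\in\mathcal X}\frac{d_h^{\pi}(s,a)}{d_h^*(s)}.$$ If instead the infimum defining $CR^H(P)$ is taken only over stationary expectations $r_h(s,a)=r(s,a)$ with $r\in[0,1]^{SA}$, then $$CR^H(P)=\max_{\pi\in\Pi^{\mathcal M}}\min_{(s,a)\in\mathcal S\times\mathcal A}\frac{\sum_{h=1}^H d_h^{\pi}(s,a)}{\sum_{h=1}^H d_h^*(s)}.$$ 3. (Worst-case environments.) For every environment (any $P$, $\mu$ and non-negative reward distribution), $CR^H(P,r)\ge\max\{\frac{1}{SAH},\frac{1}{A^H}\}$. Conversely, for every $\delta\in(0,1)$ there exist stationary environments with rewards supported in $[0,1]$ such that: if $S=A^n+1$ for some $n\in\{0,\dots,H-1\}$ then $CR^H(P,r)\le\frac{1+\delta}{(H-\log_A(S-1))(A-1)(S-1)}$; and if $S\ge A^H-1$ then $CR^H(P,r)\le\frac{1+\delta}{A^H}$.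
   Context: Episodic tabular MDP $(\mathcal S,\mathcal A,H,P,R,\mu)$: finite state space $\mathcal S$ with $|\mathcal S|=S$, finite action space $\mathcal A$ with $|\mathcal A|=A$, horizon $H\in\mathbb N$, transition kernels $P_h(\cdot\mid s,a)$, initial state distribution $\mu$, and random non-negative rewards $R_h(s,a)$ for $(h,s,a)\in\mathcal X:=[H]\times\mathcal S\times\mathcal A$. Initially $s_1\sim\mu$; at step $h$ the agent in state $s_h$ picks $a_h$, receives $R_h(s_h,a_h)$ and moves to $s_{h+1}\sim P_h(\cdot\mid s_h,a_h)$. All rewards are drawn before the interaction. The vectors $\mathcal R_h=\{R_h(s,a)\}_{s,a}$ for different $h$ are mutually independent (entries of one $\mathcal R_h$ may be arbitrarily correlated); rewards are independent of transitions, and transitions are independent across steps. Let $r_h(s,a)=\mathbb E[R_h(s,a)]$ and let $\mathcal D(r)$ denote the set of all such reward distributions with means $r$. For $L\in\{0,\dots,H\}$ an $L$-lookahead policy draws $a_h\sim\pi_h(\cdot\mid s_h,\mathcal R_h^L)$, where $\mathcal R_h^L=(\mathcal R_t)_{h\le t\le\min(h+L-1,H)}$ and $\mathcal R_h^0=\emptyset$; $\Pi^L$ is the set of these policies and $\Pi^{\mathcal M}=\Pi^0$ is the set of (possibly randomized) Markovian policies. The value is $V^{L,\pi}(P,r)=\mathbb E[\sum_{h=1}^H R_h(s_h,a_h)]$, and $V^{L,*}(P,r)=\sup_{\pi\in\Pi^L}V^{L,\pi}(P,r)$; $V^{0,*}$ depends only on $P,\mu,r$. The competitive ratio is $CR^L(P,r)=\inf_{\mathcal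 D(r)}V^{0,*}(P,r)/V^{L,*}(P,r)$, with the convention that any division by zero equals $+\infty$. Also $CR^L(P)=\inf\{CR^L(P,r): r_h\in[0,1]^{SA}\ \forall h\}$. Occupancy measures: $d_h^\pi(s)=\Pr(s_h=s)$ and $d_h^\pi(s,a)=\Pr(s_h=s,a_h=a)$ under $\pi$. For $t\le h$, $d_h^\pi(s\mid s_t=s')$ is the probability of being at $s$ at step $h$ when at $s'$ at step $t$ and following $\pi$. $d_h^*(s)=\max_{\pi\in\Pi^{\mathcal M}}d_h^\pi(s)$ and $d_h^*(s\mid s_t=s')=\max_{\pi\in\Pi^{\mathcal M}}d_h^\pi(s\mid s_t=s')$. An environment is stationary if $P_h$ and the distribution of $\mathcal R_h$ do not depend on $h$. *)

theory Defs
  imports "HOL-Probability.Probability"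
begin

text \<open>Steps are indexed 0-based: the paper's step h in [H] is step h-1 here,
  i.e. steps range over {0..<H}.  A reward realisation is a function
  R :: nat => 's => 'a => real, R h s a being the reward of (s,a) at step h.\<close>

definition eratio :: "real \<Rightarrow> real \<Rightarrow> ereal" where
  "eratio x y = (if y = 0 then \<infinity> else ereal (x / y))"

text \<open>D(r): families of reward distributions (distribution of the vector R_h for
  each step h), non-negative, with means r.  Independence across steps is imposed
  by sampling from the product measure below.\<close>
definition reward_dists ::
  "nat \<Rightarrow> (nat \<Rightarrow> 's \<Rightarrow> 'a \<Rightarrow> real) \<Rightarrow> (nat \<Rightarrow> ('s \<Rightarrow> 'a \<Rightarrow> real) measure) \<Rightarrow> bool" where
  "reward_dists H r D \<longleftrightarrow>
     (\<forall>h<H. prob_space (D h) \<and>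
        (\<forall>s a. integrable (D h) (\<lambda>X. X s a) \<and> (AE X in D h. 0 \<le> X s a) \<and>
               (\<integral>X. X s a \<partial>D h) = r h s a))"

definition reward_measure ::
  "nat \<Rightarrow> (nat \<Rightarrow> ('s \<Rightarrow> 'a \<Rightarrow> real) measure) \<Rightarrow> (nat \<Rightarrow> 's \<Rightarrow> 'a \<Rightarrow> real) measure" where
  "reward_measure H D = PiM {0..<H} D"

definition lookahead_policy ::
  "nat \<Rightarrow> nat \<Rightarrow> (nat \<Rightarrow> 's \<Rightarrow> (nat \<Rightarrow> 's \<Rightarrow> 'a \<Rightarrow> real) \<Rightarrow> 'a pmf) \<Rightarrow> bool" where
  "lookahead_policy H L \<pi> \<longleftrightarrow>
     (\<forall>h s R R'. (\<forall>t. h \<le> t \<and> t < min (h + L) H \<longrightarrow> R t = R' t) \<longrightarrow> \<pi> h s R = \<pi> h s R')"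

text \<open>Expected reward collected in k steps starting at step h in state s, given the
  reward realisation R (conditional expectation over transitions and the policy's
  randomisation).\<close>
primrec cond_value ::
  "(nat \<Rightarrow> 's::finite \<Rightarrow> 'a::finite \<Rightarrow> 's pmf) \<Rightarrow> (nat \<Rightarrow> 's \<Rightarrow> (nat \<Rightarrow> 's \<Rightarrow> 'a \<Rightarrow> real) \<Rightarrow> 'a pmf)
    \<Rightarrow> (nat \<Rightarrow> 's \<Rightarrow> 'a \<Rightarrow> real) \<Rightarrow> nat \<Rightarrow> nat \<Rightarrow> 's \<Rightarrow> real" where
  "cond_value P \<pi> R 0 h s = 0"
| "cond_value P \<pi> R (Suc k) h s =
     (\<Sum>a\<in>UNIV. pmf (\<pi> h s R) a *
        (R h s a + (\<Sum>s'\<in>UNIV. pmf (P h s a) s' * cond_value P \<pi> R k (Suc h) s')))"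

definition policy_value ::
  "nat \<Rightarrow> (nat \<Rightarrow> 's::finite \<Rightarrow> 'a::finite \<Rightarrow> 's pmf) \<Rightarrow> 's pmf \<Rightarrow> (nat \<Rightarrow> ('s \<Rightarrow> 'a \<Rightarrow> real) measure)
    \<Rightarrow> (nat \<Rightarrow> 's \<Rightarrow> (nat \<Rightarrow> 's \<Rightarrow> 'a \<Rightarrow> real) \<Rightarrow> 'a pmf) \<Rightarrow> real" where
  "policy_value H P \<mu> D \<pi> =
     (\<integral>R. (\<Sum>s\<in>UNIV. pmf \<mu> s * cond_value P \<pi> R H 0 s) \<partial>reward_measure H D)"

definition opt_value ::
  "nat \<Rightarrow> nat \<Rightarrow> (nat \<Rightarrow> 's::finite \<Rightarrow> 'a::finite \<Rightarrow> 's pmf) \<Rightarrow> 's pmf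
    \<Rightarrow> (nat \<Rightarrow> ('s \<Rightarrow> 'a \<Rightarrow> real) measure) \<Rightarrow> real" where
  "opt_value H L P \<mu> D = (SUP \<pi>\<in>{\<pi>. lookahead_policy H L \<pi>}. policy_value H P \<mu> D \<pi>)"

definition CR ::
  "nat \<Rightarrow> nat \<Rightarrow> (nat \<Rightarrow> 's::finite \<Rightarrow> 'a::finite \<Rightarrow> 's pmf) \<Rightarrow> 's pmf
    \<Rightarrow> (nat \<Rightarrow> 's \<Rightarrow> 'a \<Rightarrow> real) \<Rightarrow> ereal" where
  "CR H L P \<mu> r = (INF D\<in>{D. reward_dists H r D}. eratio (opt_value H 0 P \<mu> D) (opt_value H L P \<mu> D))"

definition CR_P ::
  "nat \<Rightarrow> nat \<Rightarrow> (nat \<Rightarrow> 's::finite \<Rightarrow> 'a::finite \<Rightarrow> 's pmf) \<Rightarrow> 's pmf \<Rightarrow> ereal" where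
  "CR_P H L P \<mu> = (INF r\<in>{r. \<forall>h<H. \<forall>s a. 0 \<le> r h s a \<and> r h s a \<le> 1}. CR H L P \<mu> r)"

definition CR_P_stat ::
  "nat \<Rightarrow> nat \<Rightarrow> (nat \<Rightarrow> 's::finite \<Rightarrow> 'a::finite \<Rightarrow> 's pmf) \<Rightarrow> 's pmf \<Rightarrow> ereal" where
  "CR_P_stat H L P \<mu> = (INF r\<in>{r. \<forall>s a. 0 \<le> r s a \<and> r s a \<le> 1}. CR H L P \<mu> (\<lambda>h. r))"

primrec occ ::
  "'s::finite pmf \<Rightarrow> (nat \<Rightarrow> 's \<Rightarrow> 'a::finite \<Rightarrow> 's pmf) \<Rightarrow> (nat \<Rightarrow> 's \<Rightarrow> 'a pmf) \<Rightarrow> nat \<Rightarrow> 's \<Rightarrow> real" where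
  "occ \<mu> P \<pi> 0 s = pmf \<mu> s"
| "occ \<mu> P \<pi> (Suc h) s' =
     (\<Sum>s\<in>UNIV. \<Sum>a\<in>UNIV. occ \<mu> P \<pi> h s * pmf (\<pi> h s) a * pmf (P h s a) s')"

definition occ_sa ::
  "'s::finite pmf \<Rightarrow> (nat \<Rightarrow> 's \<Rightarrow> 'a::finite \<Rightarrow> 's pmf) \<Rightarrow> (nat \<Rightarrow> 's \<Rightarrow> 'a pmf) \<Rightarrow> nat \<Rightarrow> 's \<Rightarrow> 'a \<Rightarrow> real" where
  "occ_sa \<mu> P \<pi> h s a = occ \<mu> P \<pi> h s * pmf (\<pi> h s) a"

definition occ_star ::
  "'s::finite pmf \<Rightarrow> (nat \<Rightarrow> 's \<Rightarrow> 'a::finite \<Rightarrow> 's pmf) \<Rightarrow> nat \<Rightarrow> 's \<Rightarrow> real" where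
  "occ_star \<mu> P h s = (SUP \<pi>::nat \<Rightarrow> 's \<Rightarrow> 'a pmf. occ \<mu> P \<pi> h s)"

definition stationary_env ::
  "nat \<Rightarrow> (nat \<Rightarrow> 's \<Rightarrow> 'a \<Rightarrow> 's pmf) \<Rightarrow> (nat \<Rightarrow> ('s \<Rightarrow> 'a \<Rightarrow> real) measure) \<Rightarrow> bool" where
  "stationary_env H P D \<longleftrightarrow> (\<forall>h. P h = P 0) \<and> (\<forall>h<H. D h = D 0)"

definition rewards_in_unit ::
  "nat \<Rightarrow> (nat \<Rightarrow> ('s \<Rightarrow> 'a \<Rightarrow> real) measure) \<Rightarrow> bool" where
  "rewards_in_unit H D \<longleftrightarrow> (\<forall>h<H. \<forall>s a. AE X in D h. 0 \<le> X s a \<and> X s a \<le> 1)"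

end

theory Submission
  imports Defs
begin

text \<open>Given a reward realisation, a lookahead policy acts like a Markov policy, so its value is at
  most \<open>\<Sum> d*(s) r(s,a)\<close>.  Long-shot rewards (each entry huge with tiny probability) make this
  bound sharp: with high probability at most one reward is nonzero, and an agent who sees it coming
  heads straight for it.  The competitive ratio is therefore a maximum of quotients of linear functionals
  of the occupancy measure, and the worst reward means come from a minimax argument: occupancy
  measures are closed under mixing, so a theorem of the alternative yields reward weights under
  which no Markov policy beats the max-min ratio.\<close>

section \<open>Occupancy measures\<close>

text \<open>The obstacle on the probabilistic side is that the supremum over lookahead policies runs
  over arbitrary functions of the realisation, measurable or not, and the integral of a
  nonintegrable value is 0 by convention. The upper bound survives because the star return is
  nonnegative; for the lower bound a policy with an integrable value has to be exhibited, and
  backward induction on the realisation yields one. Long shots are only shown to reach the bound up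
  to the factor \<open>(1 - \<epsilon>) ^ H\<close>, so the infimum is evaluated by letting
  \<open>\<epsilon>\<close> tend to 0. Maxima over Markov policies are attained by compactness of
  the space of probability tables. Occupancy is not linear in the action probabilities, so policies
  cannot be mixed directly; hence the theorem of the alternative assumes closure under mixing only
  for the values of the functions. Finally, \<open>CR\<close> takes only the means as an argument,
  so the hard environments need no randomness: a point mass at the means is an admissible reward
  distribution.\<close>

lemma sum_pmf_UNIV: "(\<Sum>x\<in>UNIV. pmf (p :: 'a::finite pmf) x) = 1"
  by (rule sum_pmf_eq_1) auto

lemma pmf_embed_finite:
  fixes f :: "'a::finite \<Rightarrow> real"
  assumes "\<And>x. 0 \<le> f x" "(\<Sum>x\<in>UNIV. f x) = 1"
  shows "pmf (embed_pmf f) x = f x"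
proof (rule pmf_embed_pmf)
  show "(\<integral>\<^sup>+ x. ennreal (f x) \<partial>count_space UNIV) = 1"
    using assms by (simp add: nn_integral_count_space_finite sum_ennreal)
qed (use assms in auto)

lemma occ_nonneg: "0 \<le> occ \<mu> P \<pi> h s"
  by (induction h arbitrary: s) (auto intro!: sum_nonneg)

lemma occ_sa_nonneg: "0 \<le> occ_sa \<mu> P \<pi> h s a"
  by (simp add: occ_sa_def occ_nonneg)

lemma sum_occ_sa: "(\<Sum>a\<in>UNIV. occ_sa \<mu> P \<pi> h s a) = occ \<mu> P \<pi> h s"
  by (simp add: occ_sa_def sum_pmf_UNIV flip: sum_distrib_left)

lemma occ_Suc: "occ \<mu> P \<pi> (Suc h) s' = (\<Sum>s\<in>UNIV. \<Sum>a\<in>UNIV. occ_sa \<mu> P \<pi> h s a * pmf (P h s a) s')"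
  by (simp add: occ_sa_def)

lemma sum_occ: "(\<Sum>s\<in>UNIV. occ \<mu> P \<pi> h s) = 1"
proof (induction h)
  case (Suc h)
  have "(\<Sum>s'\<in>UNIV. occ \<mu> P \<pi> (Suc h) s')
      = (\<Sum>s\<in>UNIV. \<Sum>a\<in>UNIV. \<Sum>s'\<in>UNIV. occ_sa \<mu> P \<pi> h s a * pmf (P h s a) s')"
    unfolding occ_Suc by (subst sum.swap, rule sum.cong[OF refl], rule sum.swap)
  also have "\<dots> = 1"
    by (simp add: sum_pmf_UNIV sum_occ_sa Suc flip: sum_distrib_left)
  finally show ?case .
qed (simp add: sum_pmf_UNIV)

lemma occ_le_1: "occ \<mu> P \<pi> h s \<le> 1"
  using member_le_sum[of s UNIV "occ \<mu> P \<pi> h"] by (simp add: sum_occ occ_nonneg)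

lemma occ_sa_le_occ: "occ_sa \<mu> P \<pi> h s a \<le> occ \<mu> P \<pi> h s"
  by (simp add: occ_sa_def mult_left_le occ_nonneg pmf_le_1)

lemma occ_cong:
  assumes "\<And>t s. t < h \<Longrightarrow> \<pi> t s = \<pi>' t s"
  shows "occ \<mu> P \<pi> h s = occ \<mu> P \<pi>' h s"
  using assms by (induction h arbitrary: s) auto

lemma occ_le_star: "occ \<mu> P \<pi> h s \<le> occ_star \<mu> P h s"
  unfolding occ_star_def
  by (rule cSUP_upper) (auto intro!: bdd_aboveI2[where M=1] occ_le_1)

lemma occ_sa_le_star: "occ_sa \<mu> P \<pi> h s a \<le> occ_star \<mu> P h s"
  using occ_sa_le_occ occ_le_star by (rule order_trans)

lemma occ_star_nonneg: "0 \<le> occ_star \<mu> P h s"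
  using occ_nonneg occ_le_star by (rule order_trans)

lemma occ_star_pos: "\<exists>s. 0 < occ_star \<mu> P h s"
proof (rule ccontr)
  assume "\<not> ?thesis"
  then have "occ_star \<mu> P h s \<le> 0" for s by (simp add: not_less)
  then have "occ \<mu> P (\<lambda>h s. return_pmf undefined) h s \<le> 0" for s
    using occ_le_star order_trans by blast
  then have "(\<Sum>s\<in>UNIV. occ \<mu> P (\<lambda>h s. return_pmf undefined) h s) \<le> 0"
    by (intro sum_nonpos) auto
  then show False by (simp add: sum_occ)
qed

text \<open>The flow equations are linear in the state-action occupancy. The mixed measure therefore
  satisfies them, and a policy is read off as its conditional law of the action given the state; in
  states without mass any action law serves.\<close>

lemma occ_sa_mixture:
  fixes \<pi>1 \<pi>2 :: "nat \<Rightarrow> 's::finite \<Rightarrow> 'a::finite pmf"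
  assumes t: "0 \<le> t" "t \<le> 1"
  shows "\<exists>\<pi>. \<forall>h s a. occ_sa \<mu> P \<pi> h s a = (1 - t) * occ_sa \<mu> P \<pi>1 h s a + t * occ_sa \<mu> P \<pi>2 h s a"
proof -
  define m where "m h s a = (1 - t) * occ_sa \<mu> P \<pi>1 h s a + t * occ_sa \<mu> P \<pi>2 h s a" for h s a
  define mo where "mo h s = (\<Sum>a\<in>UNIV. m h s a)" for h s
  define \<pi> where "\<pi> h s = (if mo h s = 0 then \<pi>1 h s else embed_pmf (\<lambda>a. m h s a / mo h s))" for h s
  have m_nonneg: "0 \<le> m h s a" for h s a
    using t by (simp add: m_def occ_sa_nonneg)
  have mo_nonneg: "0 \<le> mo h s" for h s
    by (simp add: mo_def m_nonneg sum_nonneg)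
  have mo: "mo h s = (1 - t) * occ \<mu> P \<pi>1 h s + t * occ \<mu> P \<pi>2 h s" for h s
    by (simp add: mo_def m_def sum.distrib sum_occ_sa flip: sum_distrib_left)
  have mult: "mo h s * pmf (\<pi> h s) a = m h s a" for h s a
  proof (cases "mo h s = 0")
    case True
    then have "m h s a = 0"
      unfolding mo_def using m_nonneg by (subst (asm) sum_nonneg_eq_0_iff) auto
    with True show ?thesis by simp
  next
    case False
    have "pmf (\<pi> h s) a = m h s a / mo h s"
      unfolding \<pi>_def using False
      by (simp add: pmf_embed_finite m_nonneg mo_nonneg flip: sum_divide_distrib mo_def)
    with False show ?thesis by simp
  qed
  have "occ \<mu> P \<pi> h s = mo h s" for h s
  proof (induction h arbitrary: s)
    case 0
    show ?case by (simp add: mo) (simp add: algebra_simps)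
  next
    case (Suc h)
    have "occ \<mu> P \<pi> (Suc h) s = (\<Sum>x\<in>UNIV. \<Sum>a\<in>UNIV. m h x a * pmf (P h x a) s)"
      by (simp add: Suc mult)
    also have "\<dots> = mo (Suc h) s"
      unfolding mo occ_Suc m_def
      by (simp only: sum_distrib_left sum.distrib distrib_right mult.assoc)
    finally show ?case .
  qed
  then have "occ_sa \<mu> P \<pi> h s a = m h s a" for h s a
    by (simp add: occ_sa_def mult)
  then show ?thesis unfolding m_def by blast
qed

section \<open>Compactness of the Markov policies and attained maxima\<close>

lemma compact_PiE_UNIV:
  fixes B :: "'i \<Rightarrow> 'a::topological_space set"
  assumes "\<And>i. compact (B i)"
  shows "compact (PiE UNIV B)"
proof -
  have "compactin (product_topology (\<lambda>_. euclidean) UNIV) (PiE UNIV B)"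
    by (simp only: compactin_PiE) (simp add: compactin_euclidean_iff assms)
  then show ?thesis
    by (simp only: euclidean_product_topology compactin_euclidean_iff)
qed

lemma continuous_on_coordinate3:
  "continuous_on S (\<lambda>p::'a \<Rightarrow> 'b \<Rightarrow> 'c \<Rightarrow> 'd::topological_space. p h s a)"
proof -
  have "continuous_on S (\<lambda>p::'a \<Rightarrow> 'b \<Rightarrow> 'c \<Rightarrow> 'd. p h)"
    by (rule continuous_on_subset[OF continuous_on_product_coordinates]) simp
  then have "continuous_on S (\<lambda>p::'a \<Rightarrow> 'b \<Rightarrow> 'c \<Rightarrow> 'd. p h s)"
    by (rule continuous_on_product_then_coordinatewise)
  then show ?thesis
    by (rule continuous_on_product_then_coordinatewise)
qed

text \<open>A general continuous \<open>F\<close> is allowed because three maxima are needed: of a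
  reach probability, of a return, and of a minimum of ratios.\<close>

lemma occ_sa_attains_max:
  fixes F :: "(nat \<Rightarrow> 's::finite \<Rightarrow> 'a::finite \<Rightarrow> real) \<Rightarrow> real"
  assumes F: "continuous_on UNIV F"
  shows "\<exists>\<pi>. \<forall>\<pi>'. F (occ_sa \<mu> P \<pi>') \<le> F (occ_sa \<mu> P \<pi>)"
proof -
  \<comment> \<open>Policies are represented by their probability tables. Tables have entries for
    all steps in \<open>nat\<close>, so the cube is infinite-dimensional and its compactness is
    Tychonoff's theorem.\<close>
  define B :: "(nat \<Rightarrow> 's \<Rightarrow> 'a \<Rightarrow> real) set" where "B = {p. \<forall>h s a. p h s a \<in> {0..1}}"
  define K where "K = {p. \<forall>h s. (\<Sum>a\<in>UNIV. p h s a) = 1} \<inter> B"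
  define pol where "pol p = (\<lambda>h s. embed_pmf (p h s))" for p :: "nat \<Rightarrow> 's \<Rightarrow> 'a \<Rightarrow> real"
  have "B = PiE UNIV (\<lambda>h. PiE UNIV (\<lambda>s. PiE UNIV (\<lambda>a. {0..1})))"
    by (auto simp: B_def PiE_UNIV_domain Pi_def)
  then have "compact B"
    by (simp only:) (intro compact_PiE_UNIV compact_Icc)
  moreover have "closed {p :: nat \<Rightarrow> 's \<Rightarrow> 'a \<Rightarrow> real. \<forall>h s. (\<Sum>a\<in>UNIV. p h s a) = 1}"
    by (intro closed_Collect_all closed_Collect_eq continuous_intros continuous_on_coordinate3)
  ultimately have "compact K"
    unfolding K_def by (rule closed_Int_compact[rotated])
  have pmf_pol: "pmf (pol p h s) a = p h s a" if "p \<in> K" for p h s a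
    using that unfolding pol_def K_def B_def by (intro pmf_embed_finite) auto
  have cont_pol: "continuous_on K (\<lambda>p. pmf (pol p h s) a)" for h s a
    by (rule continuous_on_eq[OF continuous_on_coordinate3]) (simp_all add: pmf_pol)
  have "continuous_on K (\<lambda>p. occ \<mu> P (pol p) h s)" for h s
    by (induction h arbitrary: s) (auto intro!: continuous_intros cont_pol)
  then have "continuous_on K (\<lambda>p. occ_sa \<mu> P (pol p))"
    unfolding occ_sa_def
    by (intro continuous_on_coordinatewise_then_product continuous_intros cont_pol)
  then have "continuous_on K (\<lambda>p. F (occ_sa \<mu> P (pol p)))"
    by (rule continuous_on_compose2[OF F]) auto
  moreover have in_K: "(\<lambda>h s. pmf (\<pi>' h s)) \<in> K" for \<pi>' :: "nat \<Rightarrow> 's \<Rightarrow> 'a pmf"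
    by (auto simp: K_def B_def sum_pmf_UNIV pmf_le_1)
  ultimately obtain p where p: "p \<in> K"
      "\<And>p'. p' \<in> K \<Longrightarrow> F (occ_sa \<mu> P (pol p')) \<le> F (occ_sa \<mu> P (pol p))"
    using continuous_attains_sup[OF \<open>compact K\<close>, of "\<lambda>p. F (occ_sa \<mu> P (pol p))"] by blast
  have "pol (\<lambda>h s. pmf (\<pi>' h s)) = \<pi>'" for \<pi>'
    by (intro ext pmf_eqI pmf_pol in_K)
  with p(2) in_K show ?thesis by metis
qed

lemma occ_star_attained:
  fixes P :: "nat \<Rightarrow> 's::finite \<Rightarrow> 'a::finite \<Rightarrow> 's pmf"
  shows "\<exists>\<pi>::nat \<Rightarrow> 's \<Rightarrow> 'a pmf. occ \<mu> P \<pi> h s = occ_star \<mu> P h s"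
proof -
  have "\<exists>\<pi>::nat \<Rightarrow> 's \<Rightarrow> 'a pmf. \<forall>\<pi>'. (\<Sum>a\<in>UNIV. occ_sa \<mu> P \<pi>' h s a) \<le> (\<Sum>a\<in>UNIV. occ_sa \<mu> P \<pi> h s a)"
    by (rule occ_sa_attains_max[of "\<lambda>d. \<Sum>a\<in>UNIV. d h s a"])
       (rule continuous_on_sum[OF continuous_on_coordinate3])
  then obtain \<pi> :: "nat \<Rightarrow> 's \<Rightarrow> 'a pmf" where \<pi>: "\<And>\<pi>'. occ \<mu> P \<pi>' h s \<le> occ \<mu> P \<pi> h s"
    unfolding sum_occ_sa by (elim exE) blast
  have "occ_star \<mu> P h s \<le> occ \<mu> P \<pi> h s"
    unfolding occ_star_def using \<pi> by (intro cSUP_least) auto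
  then show ?thesis using occ_le_star by (metis order_antisym)
qed

text \<open>Reaching \<open>s\<close> at step \<open>h\<close> involves only actions before
  \<open>h\<close>, so forcing action \<open>a\<close> at \<open>h\<close> costs nothing. This is
  why the denominators contain \<open>d*\<close> of the state alone.\<close>

lemma occ_sa_star_attained:
  fixes P :: "nat \<Rightarrow> 's::finite \<Rightarrow> 'a::finite \<Rightarrow> 's pmf"
  shows "\<exists>\<pi>::nat \<Rightarrow> 's \<Rightarrow> 'a pmf. occ_sa \<mu> P \<pi> h s a = occ_star \<mu> P h s"
proof -
  obtain \<pi> :: "nat \<Rightarrow> 's \<Rightarrow> 'a pmf" where \<pi>: "occ \<mu> P \<pi> h s = occ_star \<mu> P h s"
    using occ_star_attained by blast
  define \<pi>' where "\<pi>' = \<pi>(h := (\<lambda>_. return_pmf a))"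
  have "occ \<mu> P \<pi>' h s = occ \<mu> P \<pi> h s"
    by (rule occ_cong) (simp add: \<pi>'_def)
  then have "occ_sa \<mu> P \<pi>' h s a = occ_star \<mu> P h s"
    by (simp add: occ_sa_def \<pi> \<pi>'_def)
  then show ?thesis by blast
qed

section \<open>Values of lookahead policies\<close>

text \<open>With \<open>R\<close> frozen, \<open>\<lambda>h s. \<pi> h s R\<close> is a Markov
  policy, and its occupancy transports the value-to-go from one step to the next. The start step
  \<open>h\<close> is general for the induction; only \<open>h = 0\<close> is used later.\<close>

lemma sum_occ_cond_value:
  "(\<Sum>s\<in>UNIV. occ \<mu> P (\<lambda>h s. \<pi> h s R) h s * cond_value P \<pi> R k h s)
    = (\<Sum>j<k. \<Sum>s\<in>UNIV. \<Sum>a\<in>UNIV. occ_sa \<mu> P (\<lambda>h s. \<pi> h s R) (h + j) s a * R (h + j) s a)"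
proof (induction k arbitrary: h)
  case (Suc k)
  let ?o = "occ_sa \<mu> P (\<lambda>h s. \<pi> h s R)"
  have "(\<Sum>s\<in>UNIV. occ \<mu> P (\<lambda>h s. \<pi> h s R) h s * cond_value P \<pi> R (Suc k) h s)
      = (\<Sum>s\<in>UNIV. \<Sum>a\<in>UNIV. ?o h s a * R h s a)
        + (\<Sum>s\<in>UNIV. \<Sum>a\<in>UNIV. \<Sum>s'\<in>UNIV. ?o h s a * pmf (P h s a) s' * cond_value P \<pi> R k (Suc h) s')"
    by (simp add: occ_sa_def sum_distrib_left distrib_left sum.distrib mult.assoc)
  also have "(\<Sum>s\<in>UNIV. \<Sum>a\<in>UNIV. \<Sum>s'\<in>UNIV. ?o h s a * pmf (P h s a) s' * cond_value P \<pi> R k (Suc h) s')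
      = (\<Sum>s'\<in>UNIV. \<Sum>s\<in>UNIV. \<Sum>a\<in>UNIV. ?o h s a * pmf (P h s a) s' * cond_value P \<pi> R k (Suc h) s')"
    by (subst (2) sum.swap) (rule sum.cong[OF refl], rule sum.swap)
  also have "\<dots> = (\<Sum>s'\<in>UNIV. occ \<mu> P (\<lambda>h s. \<pi> h s R) (Suc h) s' * cond_value P \<pi> R k (Suc h) s')"
    unfolding occ_Suc sum_distrib_right ..
  finally show ?case
    by (simp add: Suc sum.lessThan_Suc_shift del: occ.simps cond_value.simps sum.lessThan_Suc)
qed simp

lemma sum_init_cond_value:
  "(\<Sum>s\<in>UNIV. pmf \<mu> s * cond_value P \<pi> R H 0 s)
    = (\<Sum>h<H. \<Sum>s\<in>UNIV. \<Sum>a\<in>UNIV. occ_sa \<mu> P (\<lambda>h s. \<pi> h s R) h s a * R h s a)"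
  using sum_occ_cond_value[of \<mu> P \<pi> R 0 H] by simp

lemma lookahead_policyD:
  assumes "lookahead_policy H L \<pi>" "\<And>t. h \<le> t \<Longrightarrow> t < min (h + L) H \<Longrightarrow> R t = R' t"
  shows "\<pi> h s R = \<pi> h s R'"
  using assms unfolding lookahead_policy_def by blast

section \<open>Backward induction in hindsight: the Bellman value of a fixed realisation\<close>

primrec dp_value ::
  "(nat \<Rightarrow> 's::finite \<Rightarrow> 'a::finite \<Rightarrow> 's pmf) \<Rightarrow> (nat \<Rightarrow> 's \<Rightarrow> 'a \<Rightarrow> real) \<Rightarrow> nat \<Rightarrow> nat \<Rightarrow> 's \<Rightarrow> real" where
  "dp_value P R 0 h s = 0"
| "dp_value P R (Suc k) h s =
     Max (range (\<lambda>a. R h s a + (\<Sum>s'\<in>UNIV. pmf (P h s a) s' * dp_value P R k (Suc h) s')))"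

lemma cond_value_le_dp_value: "cond_value P \<pi> R k h s \<le> dp_value P R k h s"
proof (induction k arbitrary: h s)
  case (Suc k)
  have "R h s a + (\<Sum>s'\<in>UNIV. pmf (P h s a) s' * cond_value P \<pi> R k (Suc h) s') \<le> dp_value P R (Suc k) h s" for a
  proof -
    have "R h s a + (\<Sum>s'\<in>UNIV. pmf (P h s a) s' * cond_value P \<pi> R k (Suc h) s')
        \<le> R h s a + (\<Sum>s'\<in>UNIV. pmf (P h s a) s' * dp_value P R k (Suc h) s')"
      by (intro add_left_mono sum_mono mult_left_mono Suc) auto
    also have "\<dots> \<le> dp_value P R (Suc k) h s"
      by simp
    finally show ?thesis .
  qed
  then have "cond_value P \<pi> R (Suc k) h s \<le> (\<Sum>a\<in>UNIV. pmf (\<pi> h s R) a * dp_value P R (Suc k) h s)"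
    unfolding cond_value.simps by (intro sum_mono mult_left_mono) auto
  also have "\<dots> = dp_value P R (Suc k) h s"
    by (simp only: sum_pmf_UNIV mult_1 flip: sum_distrib_right)
  finally show ?case .
qed simp

lemma dp_value_cong:
  assumes "\<And>t. h \<le> t \<Longrightarrow> t < h + k \<Longrightarrow> R t = R' t"
  shows "dp_value P R k h s = dp_value P R' k h s"
  using assms
proof (induction k arbitrary: h s)
  case (Suc k)
  then have "dp_value P R k (Suc h) s' = dp_value P R' k (Suc h) s'" for s'
    by simp
  with Suc.prems show ?case by simp
qed simp

text \<open>The recursion uses only finite sums and finite maxima of reward entries. This gives
  measurability of the greedy policy's value without any claim about the selection of its
  actions.\<close>

lemma borel_measurable_dp_value:
  assumes "\<And>t s a. h \<le> t \<Longrightarrow> t < h + k \<Longrightarrow> (\<lambda>R. R t s a) \<in> borel_measurable M"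
  shows "(\<lambda>R. dp_value P R k h s) \<in> borel_measurable M"
  using assms
proof (induction k arbitrary: h s)
  case (Suc k)
  show ?case
    unfolding dp_value.simps
    by (intro borel_measurable_Max borel_measurable_add borel_measurable_sum
          borel_measurable_times borel_measurable_const Suc) auto
qed simp

text \<open>The constant branch for \<open>h \<ge> H\<close> matters: the lookahead window is empty
  there, so the action law may not depend on \<open>R\<close>.\<close>

definition greedy_policy ::
  "nat \<Rightarrow> (nat \<Rightarrow> 's::finite \<Rightarrow> 'a::finite \<Rightarrow> 's pmf) \<Rightarrow> nat \<Rightarrow> 's \<Rightarrow> (nat \<Rightarrow> 's \<Rightarrow> 'a \<Rightarrow> real) \<Rightarrow> 'a pmf" where
  "greedy_policy H P h s R = return_pmf
     (if h < H then SOME a. R h s a + (\<Sum>s'\<in>UNIV. pmf (P h s a) s' * dp_value P R (H - Suc h) (Suc h) s')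
                          = dp_value P R (H - h) h s
      else undefined)"

lemma lookahead_greedy_policy:
  fixes P :: "nat \<Rightarrow> 's::finite \<Rightarrow> 'a::finite \<Rightarrow> 's pmf"
  shows "lookahead_policy H H (greedy_policy H P)"
  unfolding lookahead_policy_def
proof (intro allI impI)
  fix h s and R R' :: "nat \<Rightarrow> 's \<Rightarrow> 'a \<Rightarrow> real"
  assume *: "\<forall>t. h \<le> t \<and> t < min (h + H) H \<longrightarrow> R t = R' t"
  show "greedy_policy H P h s R = greedy_policy H P h s R'"
  proof (cases "h < H")
    case True
    have "dp_value P R (H - h) h s = dp_value P R' (H - h) h s" for s
      using * True by (intro dp_value_cong) auto
    moreover have "dp_value P R (H - Suc h) (Suc h) s = dp_value P R' (H - Suc h) (Suc h) s" for s
      using * True by (intro dp_value_cong) auto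
    ultimately show ?thesis
      using * True by (simp add: greedy_policy_def)
  qed (simp add: greedy_policy_def)
qed

lemma cond_value_greedy_policy:
  "h + k = H \<Longrightarrow> cond_value P (greedy_policy H P) R k h s = dp_value P R k h s"
proof (induction k arbitrary: h s)
  case (Suc k)
  let ?Q = "\<lambda>a. R h s a + (\<Sum>s'\<in>UNIV. pmf (P h s a) s' * dp_value P R k (Suc h) s')"
  from Suc.prems have k: "H - Suc h = k" "H - h = Suc k" "h < H" by auto
  have "dp_value P R (Suc k) h s \<in> range ?Q"
    unfolding dp_value.simps by (rule Max_in) auto
  then have "\<exists>a. ?Q a = dp_value P R (Suc k) h s" by fastforce
  then have "?Q (SOME a. ?Q a = dp_value P R (Suc k) h s) = dp_value P R (Suc k) h s"
    by (rule someI_ex)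
  moreover have "cond_value P (greedy_policy H P) R (Suc k) h s = ?Q (SOME a. ?Q a = dp_value P R (Suc k) h s)"
  proof -
    have "cond_value P (greedy_policy H P) R (Suc k) h s = (\<Sum>a\<in>UNIV. pmf (greedy_policy H P h s R) a * ?Q a)"
      using Suc by simp
    then show ?thesis
      unfolding greedy_policy_def k using \<open>h < H\<close>
      by (simp add: pmf_return indicator_def if_distrib[of "\<lambda>x. x * _"] del: dp_value.simps cong: if_cong)
  qed
  ultimately show ?case by simp
qed simp

lemma dp_value_nonneg:
  assumes "\<And>t s a. h \<le> t \<Longrightarrow> t < h + k \<Longrightarrow> 0 \<le> R t s a"
  shows "0 \<le> dp_value P R k h s"
  using assms
proof (induction k arbitrary: h s)
  case (Suc k)
  have "0 \<le> R h s undefined + (\<Sum>s'\<in>UNIV. pmf (P h s undefined) s' * dp_value P R k (Suc h) s')"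
    using Suc by (intro add_nonneg_nonneg sum_nonneg mult_nonneg_nonneg) auto
  also have "\<dots> \<le> dp_value P R (Suc k) h s"
    by simp
  finally show ?case .
qed simp

section \<open>Linear returns and the bound by maximal occupancies\<close>

definition markov_return ::
  "nat \<Rightarrow> (nat \<Rightarrow> 's::finite \<Rightarrow> 'a::finite \<Rightarrow> 's pmf) \<Rightarrow> 's pmf \<Rightarrow> (nat \<Rightarrow> 's \<Rightarrow> 'a \<Rightarrow> real) \<Rightarrow> (nat \<Rightarrow> 's \<Rightarrow> 'a pmf) \<Rightarrow> real" where
  "markov_return H P \<mu> r \<pi> = (\<Sum>h<H. \<Sum>s\<in>UNIV. \<Sum>a\<in>UNIV. occ_sa \<mu> P \<pi> h s a * r h s a)"

definition star_return ::
  "nat \<Rightarrow> (nat \<Rightarrow> 's::finite \<Rightarrow> 'a::finite \<Rightarrow> 's pmf) \<Rightarrow> 's pmf \<Rightarrow> (nat \<Rightarrow> 's \<Rightarrow> 'a \<Rightarrow> real) \<Rightarrow> real" where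
  "star_return H P \<mu> r = (\<Sum>h<H. \<Sum>s\<in>UNIV. \<Sum>a\<in>UNIV. occ_star \<mu> P h s * r h s a)"

lemma markov_return_le_star:
  assumes "\<And>h s a. h < H \<Longrightarrow> 0 \<le> r h s a"
  shows "markov_return H P \<mu> r \<pi> \<le> star_return H P \<mu> r"
  unfolding markov_return_def star_return_def
  by (intro sum_mono mult_right_mono occ_sa_le_star assms) auto

lemma markov_return_nonneg:
  assumes "\<And>h s a. h < H \<Longrightarrow> 0 \<le> r h s a"
  shows "0 \<le> markov_return H P \<mu> r \<pi>"
  unfolding markov_return_def
  by (intro sum_nonneg mult_nonneg_nonneg occ_sa_nonneg assms) auto

lemma star_return_nonneg:
  assumes "\<And>h s a. h < H \<Longrightarrow> 0 \<le> r h s a"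
  shows "0 \<le> star_return H P \<mu> r"
  unfolding star_return_def
  by (intro sum_nonneg mult_nonneg_nonneg occ_star_nonneg assms) auto

lemma occ_sa_le_markov_return:
  assumes "\<And>h s a. h < H \<Longrightarrow> 0 \<le> r h s a" "h < H"
  shows "occ_sa \<mu> P \<pi> h s a * r h s a \<le> markov_return H P \<mu> r \<pi>"
proof -
  have nn: "0 \<le> occ_sa \<mu> P \<pi> h s a * r h s a" if "h < H" for h s a
    using that assms by (simp add: occ_sa_nonneg)
  have "occ_sa \<mu> P \<pi> h s a * r h s a \<le> (\<Sum>a\<in>UNIV. occ_sa \<mu> P \<pi> h s a * r h s a)"
    using assms by (intro member_le_sum) (auto intro: nn)
  also have "\<dots> \<le> (\<Sum>s\<in>UNIV. \<Sum>a\<in>UNIV. occ_sa \<mu> P \<pi> h s a * r h s a)"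
    using assms by (intro member_le_sum[where f = "\<lambda>s. \<Sum>a\<in>UNIV. occ_sa \<mu> P \<pi> h s a * r h s a"] sum_nonneg) (auto intro: nn)
  also have "\<dots> \<le> markov_return H P \<mu> r \<pi>"
    unfolding markov_return_def
    using assms by (intro member_le_sum[where f = "\<lambda>h. \<Sum>s\<in>UNIV. \<Sum>a\<in>UNIV. occ_sa \<mu> P \<pi> h s a * r h s a"] sum_nonneg) (auto intro: nn)
  finally show ?thesis .
qed

lemma markov_return_attains_max:
  fixes P :: "nat \<Rightarrow> 's::finite \<Rightarrow> 'a::finite \<Rightarrow> 's pmf"
  shows "\<exists>\<pi>::nat \<Rightarrow> 's \<Rightarrow> 'a pmf. \<forall>\<pi>'. markov_return H P \<mu> r \<pi>' \<le> markov_return H P \<mu> r \<pi>"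
  unfolding markov_return_def
  by (rule occ_sa_attains_max[of "\<lambda>d. \<Sum>h<H. \<Sum>s\<in>UNIV. \<Sum>a\<in>UNIV. d h s a * r h s a"])
     (intro continuous_on_sum continuous_on_mult_right continuous_on_coordinate3)

text \<open>A policy may chase one single entry with the largest reach probability; the other
  rewards are nonnegative and can only help, and the hindsight value dominates every policy.\<close>

lemma occ_star_le_dp_value:
  assumes R: "\<And>h s a. h < H \<Longrightarrow> 0 \<le> R h s a" and h: "h < H"
  shows "occ_star \<mu> P h s * R h s a \<le> (\<Sum>s\<in>UNIV. pmf \<mu> s * dp_value P R H 0 s)"
proof -
  obtain \<pi> where \<pi>: "occ_sa \<mu> P \<pi> h s a = occ_star \<mu> P h s"
    using occ_sa_star_attained by blast
  have "occ_star \<mu> P h s * R h s a \<le> markov_return H P \<mu> R \<pi>"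
    using occ_sa_le_markov_return[where r=R, OF R h] by (simp flip: \<pi>)
  also have "\<dots> = (\<Sum>s\<in>UNIV. pmf \<mu> s * cond_value P (\<lambda>h s R. \<pi> h s) R H 0 s)"
    unfolding sum_init_cond_value markov_return_def ..
  also have "\<dots> \<le> (\<Sum>s\<in>UNIV. pmf \<mu> s * dp_value P R H 0 s)"
    by (intro sum_mono mult_left_mono cond_value_le_dp_value) auto
  finally show ?thesis .
qed

section \<open>Expectations over independent reward vectors\<close>

context
  fixes H :: nat and r :: "nat \<Rightarrow> 's::finite \<Rightarrow> 'a::finite \<Rightarrow> real" and D
  assumes D: "reward_dists H r D"
begin

lemma distr_reward_measure:
  assumes "h < H"
  shows "distr (reward_measure H D) (D h) (\<lambda>R. R h) = D h"
  unfolding reward_measure_def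
  using D assms by (intro distr_PiM_component) (auto simp: reward_dists_def)

lemma measurable_reward_component: "h < H \<Longrightarrow> (\<lambda>R. R h) \<in> measurable (reward_measure H D) (D h)"
  unfolding reward_measure_def by (rule measurable_component_singleton) simp

lemma measurable_reward_entry: "h < H \<Longrightarrow> (\<lambda>X. X s a) \<in> borel_measurable (D h)"
  using D by (intro borel_measurable_integrable) (auto simp: reward_dists_def)

lemma borel_measurable_reward:
  "h < H \<Longrightarrow> (\<lambda>R. R h s a) \<in> borel_measurable (reward_measure H D)"
  using measurable_compose[OF measurable_reward_component measurable_reward_entry] .

lemma integrable_reward:
  assumes "h < H" shows "integrable (reward_measure H D) (\<lambda>R. R h s a)"
  using D assms integrable_distr[OF measurable_reward_component, of h "\<lambda>X. X s a"]
  by (simp add: distr_reward_measure reward_dists_def)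

lemma integral_reward:
  assumes "h < H" shows "(\<integral>R. R h s a \<partial>reward_measure H D) = r h s a"
  using D assms integral_distr[OF measurable_reward_component measurable_reward_entry, of h s a]
  by (simp add: distr_reward_measure reward_dists_def)

lemma AE_reward_nonneg:
  "AE R in reward_measure H D. \<forall>h<H. \<forall>s a. 0 \<le> R h s a"
proof -
  have "AE R in reward_measure H D. 0 \<le> R h s a" if "h < H" for h s a
    unfolding reward_measure_def
    using D that by (intro AE_PiM_component[where P = "\<lambda>X. 0 \<le> X s a"]) (auto simp: reward_dists_def)
  then have "AE R in reward_measure H D. \<forall>h\<in>{..<H}. \<forall>s\<in>UNIV. \<forall>a\<in>UNIV. 0 \<le> R h s a"
    by (intro AE_finite_allI) auto
  then show ?thesis by (rule eventually_mono) auto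
qed

lemma reward_mean_nonneg: "h < H \<Longrightarrow> 0 \<le> r h s a"
  unfolding integral_reward[symmetric]
  by (rule integral_nonneg_AE, rule eventually_mono[OF AE_reward_nonneg]) blast

lemma integral_weighted_rewards:
  "integrable (reward_measure H D) (\<lambda>R. \<Sum>h<H. \<Sum>s\<in>UNIV. \<Sum>a\<in>UNIV. c h s a * R h s a)"
  "(\<integral>R. (\<Sum>h<H. \<Sum>s\<in>UNIV. \<Sum>a\<in>UNIV. c h s a * R h s a) \<partial>reward_measure H D)
    = (\<Sum>h<H. \<Sum>s\<in>UNIV. \<Sum>a\<in>UNIV. c h s a * r h s a)"
proof -
  have i: "integrable (reward_measure H D) (\<lambda>R. c h s a * R h s a)" if "h \<in> {..<H}" for h s a
    using that integrable_reward by auto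
  show "integrable (reward_measure H D) (\<lambda>R. \<Sum>h<H. \<Sum>s\<in>UNIV. \<Sum>a\<in>UNIV. c h s a * R h s a)"
    by (intro Bochner_Integration.integrable_sum i)
  show "(\<integral>R. (\<Sum>h<H. \<Sum>s\<in>UNIV. \<Sum>a\<in>UNIV. c h s a * R h s a) \<partial>reward_measure H D)
    = (\<Sum>h<H. \<Sum>s\<in>UNIV. \<Sum>a\<in>UNIV. c h s a * r h s a)"
  proof -
    have "(\<integral>R. (\<Sum>h<H. \<Sum>s\<in>UNIV. \<Sum>a\<in>UNIV. c h s a * R h s a) \<partial>reward_measure H D)
        = (\<Sum>h<H. \<integral>R. (\<Sum>s\<in>UNIV. \<Sum>a\<in>UNIV. c h s a * R h s a) \<partial>reward_measure H D)"
      by (intro Bochner_Integration.integral_sum Bochner_Integration.integrable_sum i)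
    also have "\<dots> = (\<Sum>h<H. \<Sum>s\<in>UNIV. \<integral>R. (\<Sum>a\<in>UNIV. c h s a * R h s a) \<partial>reward_measure H D)"
      by (intro sum.cong refl Bochner_Integration.integral_sum Bochner_Integration.integrable_sum i)
    also have "\<dots> = (\<Sum>h<H. \<Sum>s\<in>UNIV. \<Sum>a\<in>UNIV. \<integral>R. c h s a * R h s a \<partial>reward_measure H D)"
      by (intro sum.cong refl Bochner_Integration.integral_sum i)
    finally show ?thesis by (simp add: integral_reward)
  qed
qed

lemma policy_value_markov:
  "policy_value H P \<mu> D (\<lambda>h s R. \<pi> h s) = markov_return H P \<mu> r \<pi>"
  unfolding policy_value_def sum_init_cond_value integral_weighted_rewards(2) markov_return_def ..

lemma init_cond_value_le_star:
  fixes P :: "nat \<Rightarrow> 's::finite \<Rightarrow> 'a::finite \<Rightarrow> 's pmf"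
  assumes "\<And>h s a. h < H \<Longrightarrow> 0 \<le> R h s a"
  shows "(\<Sum>s\<in>UNIV. pmf \<mu> s * cond_value P \<pi> R H 0 s) \<le> star_return H P \<mu> R"
  using markov_return_le_star[of H R P \<mu> "\<lambda>h s. \<pi> h s R", OF assms]
  unfolding sum_init_cond_value markov_return_def by simp

lemma policy_value_le_star: "policy_value H P \<mu> D \<pi> \<le> star_return H P \<mu> r"
proof (cases "integrable (reward_measure H D) (\<lambda>R. \<Sum>s\<in>UNIV. pmf \<mu> s * cond_value P \<pi> R H 0 s)")
  case True
  have "policy_value H P \<mu> D \<pi> \<le> (\<integral>R. star_return H P \<mu> R \<partial>reward_measure H D)"
    unfolding policy_value_def
  proof (rule integral_mono_AE[OF True])
    show "integrable (reward_measure H D) (star_return H P \<mu>)"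
      unfolding star_return_def by (rule integral_weighted_rewards)
    show "AE R in reward_measure H D. (\<Sum>s\<in>UNIV. pmf \<mu> s * cond_value P \<pi> R H 0 s) \<le> star_return H P \<mu> R"
      using AE_reward_nonneg by (rule eventually_mono) (auto intro!: init_cond_value_le_star)
  qed
  also have "\<dots> = star_return H P \<mu> r"
    unfolding star_return_def by (rule integral_weighted_rewards)
  finally show ?thesis .
next
  case False
  \<comment> \<open>A lookahead policy may be nonmeasurable in \<open>R\<close>. Its integral is
    then 0 by convention, which the nonnegative star return still dominates.\<close>
  then have "policy_value H P \<mu> D \<pi> = 0"
    by (simp add: policy_value_def not_integrable_integral_eq)
  also have "0 \<le> star_return H P \<mu> r"
    by (intro star_return_nonneg reward_mean_nonneg)
  finally show ?thesis .
qed

text \<open>The real-valued \<open>SUP\<close> is meaningful only for a set bounded above; the star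
  return supplies the bound.\<close>

lemma policy_value_le_opt_value:
  "lookahead_policy H L \<pi> \<Longrightarrow> policy_value H P \<mu> D \<pi> \<le> opt_value H L P \<mu> D"
  unfolding opt_value_def
  by (rule cSUP_upper) (auto intro!: bdd_aboveI2 policy_value_le_star)

lemma markov_return_le_opt_value: "markov_return H P \<mu> r \<pi> \<le> opt_value H L P \<mu> D"
  using policy_value_le_opt_value[of L "\<lambda>h s R. \<pi> h s" P \<mu>]
  by (simp add: policy_value_markov lookahead_policy_def)

lemma opt_value_le_star: "opt_value H L P \<mu> D \<le> star_return H P \<mu> r"
  unfolding opt_value_def
  by (rule cSUP_least) (auto intro!: policy_value_le_star exI[of _ "\<lambda>h s R. return_pmf undefined"] simp: lookahead_policy_def)

lemma opt_value_0:
  assumes "\<And>\<pi>'. markov_return H P \<mu> r \<pi>' \<le> markov_return H P \<mu> r \<pi>"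
  shows "opt_value H 0 P \<mu> D = markov_return H P \<mu> r \<pi>"
proof (rule antisym)
  show "opt_value H 0 P \<mu> D \<le> markov_return H P \<mu> r \<pi>"
    unfolding opt_value_def
  proof (rule cSUP_least)
    fix \<pi>' :: "nat \<Rightarrow> 's \<Rightarrow> (nat \<Rightarrow> 's \<Rightarrow> 'a \<Rightarrow> real) \<Rightarrow> 'a pmf"
    assume "\<pi>' \<in> {\<pi>. lookahead_policy H 0 \<pi>}"
    then have "lookahead_policy H 0 \<pi>'" by simp
    \<comment> \<open>With lookahead 0 the window is empty, so all realisations give the same action
      law and \<open>undefined\<close> is an arbitrary representative.\<close>
    then have "\<pi>' h s R = \<pi>' h s undefined" for h s R
      by (rule lookahead_policyD) simp_all
    then obtain \<pi>0 where "\<pi>' = (\<lambda>h s R. \<pi>0 h s)"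
      by (intro that[of "\<lambda>h s. \<pi>' h s undefined"] ext)
    then show "policy_value H P \<mu> D \<pi>' \<le> markov_return H P \<mu> r \<pi>"
      by (simp add: policy_value_markov assms)
  qed (auto intro!: exI[of _ "\<lambda>h s R. return_pmf undefined"] simp: lookahead_policy_def)
qed (rule markov_return_le_opt_value)

text \<open>Almost surely the hindsight value lies between 0 and the star return of the realisation,
  which is integrable.\<close>

lemma integrable_sum_dp_value:
  "integrable (reward_measure H D) (\<lambda>R. \<Sum>s\<in>UNIV. pmf \<mu> s * dp_value P R H 0 s)"
proof (rule Bochner_Integration.integrable_bound)
  show "integrable (reward_measure H D) (star_return H P \<mu>)"
    unfolding star_return_def by (rule integral_weighted_rewards)
  show "(\<lambda>R. \<Sum>s\<in>UNIV. pmf \<mu> s * dp_value P R H 0 s) \<in> borel_measurable (reward_measure H D)"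
    by (intro borel_measurable_sum borel_measurable_times borel_measurable_const
        borel_measurable_dp_value borel_measurable_reward) auto
  have *: "norm (\<Sum>s\<in>UNIV. pmf \<mu> s * dp_value P R H 0 s) \<le> norm (star_return H P \<mu> R)"
    if R: "\<forall>h<H. \<forall>s a. 0 \<le> R h s a" for R
  proof -
    have "0 \<le> (\<Sum>s\<in>UNIV. pmf \<mu> s * dp_value P R H 0 s)"
      using R by (intro sum_nonneg mult_nonneg_nonneg dp_value_nonneg) auto
    moreover have "(\<Sum>s\<in>UNIV. pmf \<mu> s * dp_value P R H 0 s) \<le> star_return H P \<mu> R"
      using init_cond_value_le_star[of R \<mu> P "greedy_policy H P"] R by (simp add: cond_value_greedy_policy)
    ultimately show ?thesis by simp
  qed
  show "AE R in reward_measure H D. norm (\<Sum>s\<in>UNIV. pmf \<mu> s * dp_value P R H 0 s) \<le> norm (star_return H P \<mu> R)"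
    using AE_reward_nonneg by (rule eventually_mono) (rule *)
qed

lemma integral_dp_value_le_opt_value:
  "(\<integral>R. (\<Sum>s\<in>UNIV. pmf \<mu> s * dp_value P R H 0 s) \<partial>reward_measure H D) \<le> opt_value H H P \<mu> D"
  using policy_value_le_opt_value[OF lookahead_greedy_policy, of P \<mu> P]
  by (simp add: policy_value_def cond_value_greedy_policy)

end

section \<open>Long-shot reward distributions\<close>

text \<open>The factor \<open>CARD('s \<times> 'a) / \<epsilon>\<close> is the inverse of the
  probability that the pair \<open>x\<close> is hit, so the mean of each entry is preserved.\<close>

definition spike :: "real \<Rightarrow> ('s \<Rightarrow> 'a \<Rightarrow> real) \<Rightarrow> 's \<times> 'a \<Rightarrow> 's::finite \<Rightarrow> 'a::finite \<Rightarrow> real" where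
  "spike \<epsilon> \<rho> x s a = (if x = (s, a) then \<rho> s a * real CARD('s \<times> 'a) / \<epsilon> else 0)"

text \<open>One coin serves the whole step and then one pair is chosen, so the entries within a step
  are correlated and at most one is nonzero. Simultaneous rewards can then come only from different
  steps, which are independent.\<close>

definition long_shot_pmf :: "real \<Rightarrow> ('s::finite \<Rightarrow> 'a::finite \<Rightarrow> real) \<Rightarrow> ('s \<Rightarrow> 'a \<Rightarrow> real) pmf" where
  "long_shot_pmf \<epsilon> \<rho> = map_pmf (\<lambda>(b, x). if b then spike \<epsilon> \<rho> x else (\<lambda>_ _. 0))
     (pair_pmf (bernoulli_pmf \<epsilon>) (pmf_of_set UNIV))"

definition long_shot ::
  "real \<Rightarrow> (nat \<Rightarrow> 's::finite \<Rightarrow> 'a::finite \<Rightarrow> real) \<Rightarrow> nat \<Rightarrow> ('s \<Rightarrow> 'a \<Rightarrow> real) measure" where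
  "long_shot \<epsilon> r h = measure_pmf (long_shot_pmf \<epsilon> (r h))"

lemma finite_set_long_shot_pmf: "finite (set_pmf (long_shot_pmf \<epsilon> \<rho>))"
  unfolding long_shot_pmf_def set_map_pmf by (rule finite_imageI) simp

lemma integrable_long_shot:
  fixes g :: "('s::finite \<Rightarrow> 'a::finite \<Rightarrow> real) \<Rightarrow> real"
  shows "integrable (long_shot \<epsilon> r h) g"
  unfolding long_shot_def by (rule integrable_measure_pmf_finite[OF finite_set_long_shot_pmf])

lemma integral_long_shot:
  fixes g :: "('s::finite \<Rightarrow> 'a::finite \<Rightarrow> real) \<Rightarrow> real"
  assumes "0 \<le> \<epsilon>" "\<epsilon> \<le> 1"
  shows "(\<integral>X. g X \<partial>long_shot \<epsilon> r h)
    = \<epsilon> / real CARD('s \<times> 'a) * (\<Sum>x\<in>UNIV. g (spike \<epsilon> (r h) x)) + (1 - \<epsilon>) * g (\<lambda>_ _. 0)"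
proof -
  have "(\<integral>X. g X \<partial>long_shot \<epsilon> r h)
     = (\<Sum>(b, x)\<in>UNIV. g (if b then spike \<epsilon> (r h) x else (\<lambda>_ _. 0)) * (pmf (bernoulli_pmf \<epsilon>) b / real CARD('s \<times> 'a)))"
    unfolding long_shot_def long_shot_pmf_def
    by (subst integral_map_pmf, subst integral_measure_pmf_real[where A=UNIV])
       (auto intro!: sum.cong simp: pmf_pair)
  also have "\<dots> = (\<Sum>b\<in>UNIV. \<Sum>x\<in>UNIV. g (if b then spike \<epsilon> (r h) x else (\<lambda>_ _. 0)) * (pmf (bernoulli_pmf \<epsilon>) b / real CARD('s \<times> 'a)))"
    by (simp only: sum.cartesian_product UNIV_Times_UNIV)
  also have "\<dots> = \<epsilon> / real CARD('s \<times> 'a) * (\<Sum>x\<in>UNIV. g (spike \<epsilon> (r h) x)) + (1 - \<epsilon>) * g (\<lambda>_ _. 0)"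
    using assms by (simp add: UNIV_bool sum_distrib_left mult.commute sum_divide_distrib)
  finally show ?thesis .
qed

lemma sum_spike:
  fixes \<rho> c :: "'s::finite \<Rightarrow> 'a::finite \<Rightarrow> real"
  shows "(\<Sum>s\<in>UNIV. \<Sum>a\<in>UNIV. c s a * spike \<epsilon> \<rho> x s a)
    = c (fst x) (snd x) * (\<rho> (fst x) (snd x) * real CARD('s \<times> 'a) / \<epsilon>)"
proof -
  have "(\<Sum>s\<in>UNIV. \<Sum>a\<in>UNIV. c s a * spike \<epsilon> \<rho> x s a) = (\<Sum>y\<in>UNIV. c (fst y) (snd y) * spike \<epsilon> \<rho> x (fst y) (snd y))"
    by (simp add: sum.cartesian_product UNIV_Times_UNIV case_prod_unfold)
  also have "\<dots> = (\<Sum>y\<in>UNIV. if x = y then c (fst x) (snd x) * (\<rho> (fst x) (snd x) * real CARD('s \<times> 'a) / \<epsilon>) else 0)"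
    by (intro sum.cong) (auto simp: spike_def)
  finally show ?thesis by simp
qed

lemma integral_long_shot_linear:
  fixes c :: "'s::finite \<Rightarrow> 'a::finite \<Rightarrow> real"
  assumes "0 < \<epsilon>" "\<epsilon> \<le> 1"
  shows "(\<integral>X. (\<Sum>s\<in>UNIV. \<Sum>a\<in>UNIV. c s a * X s a) \<partial>long_shot \<epsilon> r h) = (\<Sum>s\<in>UNIV. \<Sum>a\<in>UNIV. c s a * r h s a)"
proof -
  have "(\<Sum>x\<in>UNIV. c (fst x) (snd x) * r h (fst x) (snd x)) = (\<Sum>s\<in>UNIV. \<Sum>a\<in>UNIV. c s a * r h s a)"
    by (simp add: sum.cartesian_product UNIV_Times_UNIV case_prod_unfold)
  with assms show ?thesis
    by (simp add: integral_long_shot sum_spike sum_distrib_left)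
qed

lemma reward_dists_long_shot:
  fixes r :: "nat \<Rightarrow> 's::finite \<Rightarrow> 'a::finite \<Rightarrow> real"
  assumes "0 < \<epsilon>" "\<epsilon> \<le> 1" and r: "\<And>h s a. h < H \<Longrightarrow> 0 \<le> r h s a"
  shows "reward_dists H r (long_shot \<epsilon> r)"
  unfolding reward_dists_def
proof (intro allI impI conjI)
  fix h s a assume h: "h < H"
  show "prob_space (long_shot \<epsilon> r h)"
    unfolding long_shot_def by (rule prob_space_measure_pmf)
  show "AE X in long_shot \<epsilon> r h. 0 \<le> X s a"
    unfolding long_shot_def using assms h
    by (auto simp: AE_measure_pmf_iff long_shot_pmf_def spike_def)
  have "(\<integral>X. X s a \<partial>long_shot \<epsilon> r h)
      = (\<integral>X. (\<Sum>s'\<in>UNIV. \<Sum>a'\<in>UNIV. of_bool (s' = s \<and> a' = a) * X s' a') \<partial>long_shot \<epsilon> r h)"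
    by (simp add: of_bool_conj mult.assoc flip: sum_distrib_left)
  also have "\<dots> = r h s a"
    unfolding integral_long_shot_linear[OF assms(1,2)]
    by (simp add: of_bool_conj mult.assoc flip: sum_distrib_left)
  finally show "(\<integral>X. X s a \<partial>long_shot \<epsilon> r h) = r h s a" .
qed (rule integrable_long_shot)

text \<open>When exactly one reward is nonzero, an agent that sees it in advance collects it
  with the largest probability of reaching its state.  Simultaneous long shots have
  vanishing probability.\<close>

lemma opt_value_long_shot_ge:
  fixes P :: "nat \<Rightarrow> 's::finite \<Rightarrow> 'a::finite \<Rightarrow> 's pmf"
  assumes \<epsilon>: "0 < \<epsilon>" "\<epsilon> \<le> 1" and r: "\<And>h s a. h < H \<Longrightarrow> 0 \<le> r h s a"
  shows "(1 - \<epsilon>) ^ H * star_return H P \<mu> r \<le> opt_value H H P \<mu> (long_shot \<epsilon> r)"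
proof -
  let ?D = "long_shot \<epsilon> r" and ?M = "reward_measure H (long_shot \<epsilon> r)"
  define Z where "Z h X = (\<Sum>s\<in>UNIV. \<Sum>a\<in>UNIV. occ_star \<mu> P h s * X s a)" for h and X :: "'s \<Rightarrow> 'a \<Rightarrow> real"
  \<comment> \<open>The product of \<open>f h t (R t)\<close> over \<open>t\<close> is
    \<open>Z h (R h)\<close> times the indicator that all other steps are silent. The product form
    lets the expectation factorise over independent steps.\<close>
  define f where "f h t X = (if t = h then Z h X else of_bool (X = (\<lambda>_ _. 0)))" for h t X
  interpret D: product_prob_space ?D "{0..<H}"
    by (intro product_prob_spaceI) (simp add: long_shot_def prob_space_measure_pmf)
  have dists: "reward_dists H r ?D"
    by (rule reward_dists_long_shot[OF \<epsilon> r])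
  have Z_nonneg: "0 \<le> (\<Sum>s\<in>UNIV. \<Sum>a\<in>UNIV. occ_star \<mu> P h s * r h s a)" if "h < H" for h
    using that by (intro sum_nonneg mult_nonneg_nonneg occ_star_nonneg r)
  have "(1 - \<epsilon>) ^ H * star_return H P \<mu> r
      = (\<Sum>h<H. (1 - \<epsilon>) ^ H * (\<Sum>s\<in>UNIV. \<Sum>a\<in>UNIV. occ_star \<mu> P h s * r h s a))"
    by (simp add: star_return_def sum_distrib_left)
  also have "\<dots> \<le> (\<Sum>h<H. \<Prod>t\<in>{0..<H}. \<integral>X. f h t X \<partial>?D t)"
  proof (rule sum_mono)
    fix h assume "h \<in> {..<H}"
    then have h: "h < H" by simp
    have "(\<Prod>t\<in>{0..<H}. \<integral>X. f h t X \<partial>?D t)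
        = (\<integral>X. f h h X \<partial>?D h) * (\<Prod>t\<in>{0..<H} - {h}. \<integral>X. f h t X \<partial>?D t)"
      using h by (intro prod.remove) auto
    moreover have "(\<integral>X. f h h X \<partial>?D h) = (\<Sum>s\<in>UNIV. \<Sum>a\<in>UNIV. occ_star \<mu> P h s * r h s a)"
      by (simp add: f_def Z_def integral_long_shot_linear[OF \<epsilon>])
    moreover have "(1 - \<epsilon>) ^ H \<le> (\<Prod>t\<in>{0..<H} - {h}. \<integral>X. f h t X \<partial>?D t)"
    proof -
      \<comment> \<open>Only \<open>H - 1\<close> steps must be silent; rounding the exponent up to
        \<open>H\<close> is harmless in the limit.\<close>
      have "(1 - \<epsilon>) ^ H \<le> (1 - \<epsilon>) ^ card ({0..<H} - {h})"
        using \<epsilon> by (intro power_decreasing) (auto intro: order_trans[OF card_Diff1_le])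
      also have "\<dots> = (\<Prod>t\<in>{0..<H} - {h}. 1 - \<epsilon>)" by simp
      also have "\<dots> \<le> (\<Prod>t\<in>{0..<H} - {h}. \<integral>X. f h t X \<partial>?D t)"
        using \<epsilon> by (intro prod_mono) (auto simp: f_def integral_long_shot)
      finally show ?thesis .
    qed
    ultimately show "(1 - \<epsilon>) ^ H * (\<Sum>s\<in>UNIV. \<Sum>a\<in>UNIV. occ_star \<mu> P h s * r h s a)
        \<le> (\<Prod>t\<in>{0..<H}. \<integral>X. f h t X \<partial>?D t)"
      by (subst mult.commute) (simp only: mult_left_mono Z_nonneg[OF h])
  qed
  also have "\<dots> = (\<Sum>h<H. \<integral>R. (\<Prod>t\<in>{0..<H}. f h t (R t)) \<partial>?M)"
    unfolding reward_measure_def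
    by (intro sum.cong refl D.product_integral_prod[symmetric] integrable_long_shot) simp
  also have "\<dots> = (\<integral>R. (\<Sum>h<H. \<Prod>t\<in>{0..<H}. f h t (R t)) \<partial>?M)"
    unfolding reward_measure_def
    by (intro Bochner_Integration.integral_sum[symmetric] D.product_integrable_prod integrable_long_shot) simp
  also have "\<dots> \<le> (\<integral>R. (\<Sum>s\<in>UNIV. pmf \<mu> s * dp_value P R H 0 s) \<partial>?M)"
  proof (rule integral_mono_AE)
    show "integrable ?M (\<lambda>R. \<Sum>h<H. \<Prod>t\<in>{0..<H}. f h t (R t))"
      unfolding reward_measure_def
      by (intro Bochner_Integration.integrable_sum D.product_integrable_prod integrable_long_shot) simp
    show "integrable ?M (\<lambda>R. \<Sum>s\<in>UNIV. pmf \<mu> s * dp_value P R H 0 s)"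
      by (rule integrable_sum_dp_value[OF dists])
    have "AE X in ?D h. X = (\<lambda>_ _. 0) \<or> (\<exists>x. X = spike \<epsilon> (r h) x)" for h
      unfolding long_shot_def by (auto simp: AE_measure_pmf_iff long_shot_pmf_def)
    then have "AE R in ?M. \<forall>h\<in>{0..<H}. R h = (\<lambda>_ _. 0) \<or> (\<exists>x. R h = spike \<epsilon> (r h) x)"
      unfolding reward_measure_def
      by (intro AE_finite_allI AE_PiM_component[where P = "\<lambda>X. X = (\<lambda>_ _. 0) \<or> (\<exists>x. X = spike \<epsilon> (r h) x)" for h] D.prob_space)
         auto
    then show "AE R in ?M. (\<Sum>h<H. \<Prod>t\<in>{0..<H}. f h t (R t)) \<le> (\<Sum>s\<in>UNIV. pmf \<mu> s * dp_value P R H 0 s)"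
    proof (rule eventually_mono)
      fix R assume R: "\<forall>h\<in>{0..<H}. R h = (\<lambda>_ _. 0) \<or> (\<exists>x. R h = spike \<epsilon> (r h) x)"
      have R_nonneg: "0 \<le> R h s a" if "h < H" for h s a
      proof -
        have "0 \<le> spike \<epsilon> (r h) x s a" for x
          using r[OF that] \<epsilon> by (simp add: spike_def)
        then show ?thesis
          using bspec[OF R, of h] that by auto
      qed
      have dp: "0 \<le> (\<Sum>s\<in>UNIV. pmf \<mu> s * dp_value P R H 0 s)"
        by (intro sum_nonneg mult_nonneg_nonneg dp_value_nonneg R_nonneg) auto
      show "(\<Sum>h<H. \<Prod>t\<in>{0..<H}. f h t (R t)) \<le> (\<Sum>s\<in>UNIV. pmf \<mu> s * dp_value P R H 0 s)"
      proof (cases "\<exists>h<H. R h \<noteq> (\<lambda>_ _. 0)")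
        \<comment> \<open>No reward at all: each product contains the factor \<open>Z h\<close> at
          the zero vector.\<close>
        case False
        then have "(\<Prod>t\<in>{0..<H}. f h t (R t)) = 0" if "h < H" for h
          using that by (intro prod_zero) (auto intro!: bexI[of _ h] simp: f_def Z_def)
        then have "(\<Sum>h<H. \<Prod>t\<in>{0..<H}. f h t (R t)) = 0"
          by (intro sum.neutral ballI) (simp only: lessThan_iff)
        with dp show ?thesis by (simp only:)
      next
        case True
        then obtain h where h: "h < H" "R h \<noteq> (\<lambda>_ _. 0)" by blast
        have "\<exists>x. R h = spike \<epsilon> (r h) x"
          using bspec[OF R, of h] h by simp
        then obtain s a where x: "R h = spike \<epsilon> (r h) (s, a)" by (metis surj_pair)
        \<comment> \<open>The summand of any other step demands silence at \<open>h\<close>, where a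
          reward occurs.\<close>
        have "(\<Prod>t\<in>{0..<H}. f h' t (R t)) = 0" if "h' \<in> {..<H} - {h}" for h'
          using that h by (intro prod_zero) (auto intro!: bexI[of _ h] simp: f_def)
        then have "(\<Sum>h'\<in>{..<H} - {h}. \<Prod>t\<in>{0..<H}. f h' t (R t)) = 0"
          by (rule sum.neutral[OF ballI])
        moreover have "(\<Sum>h<H. \<Prod>t\<in>{0..<H}. f h t (R t))
            = (\<Prod>t\<in>{0..<H}. f h t (R t)) + (\<Sum>h'\<in>{..<H} - {h}. \<Prod>t\<in>{0..<H}. f h' t (R t))"
          using h by (intro sum.remove) simp_all
        ultimately have "(\<Sum>h<H. \<Prod>t\<in>{0..<H}. f h t (R t)) = (\<Prod>t\<in>{0..<H}. f h t (R t))"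
          by (simp only: add_0_right)
        also have "\<dots> = f h h (R h) * (\<Prod>t\<in>{0..<H} - {h}. f h t (R t))"
          using h by (intro prod.remove) simp_all
        also have "f h h (R h) = Z h (R h)"
          by (simp add: f_def)
        \<comment> \<open>Only an inequality: a second long shot at another step makes the remaining
          product 0.\<close>
        also have "Z h (R h) * (\<Prod>t\<in>{0..<H} - {h}. f h t (R t)) \<le> Z h (R h)"
        proof (rule mult_left_le)
          show "(\<Prod>t\<in>{0..<H} - {h}. f h t (R t)) \<le> 1"
            by (intro prod_le_1) (auto simp: f_def)
          show "0 \<le> Z h (R h)"
            unfolding Z_def using h by (intro sum_nonneg mult_nonneg_nonneg occ_star_nonneg R_nonneg)
        qed
        also have "Z h (R h) = occ_star \<mu> P h s * R h s a"
          unfolding Z_def x sum_spike by (simp add: spike_def)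
        also have "\<dots> \<le> (\<Sum>s\<in>UNIV. pmf \<mu> s * dp_value P R H 0 s)"
          using R_nonneg h(1) by (rule occ_star_le_dp_value)
        finally show ?thesis .
      qed
    qed
  qed
  also have "\<dots> \<le> opt_value H H P \<mu> ?D"
    by (rule integral_dp_value_le_opt_value[OF dists])
  finally show ?thesis .
qed

section \<open>The competitive ratio at fixed reward means\<close>

lemma eratio_mono: "x \<le> x' \<Longrightarrow> 0 \<le> y \<Longrightarrow> eratio x y \<le> eratio x' y"
  by (simp add: eratio_def divide_right_mono)

text \<open>The numerator is the same for all admissible distributions, so the infimum only pushes
  the denominator up: the star return bounds it, and long shots approach that bound as
  \<open>\<epsilon>\<close> tends to 0.\<close>

lemma CR_eq_eratio:
  fixes P :: "nat \<Rightarrow> 's::finite \<Rightarrow> 'a::finite \<Rightarrow> 's pmf"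
  assumes r: "\<And>h s a. h < H \<Longrightarrow> 0 \<le> r h s a"
    and max: "\<And>\<pi>'. markov_return H P \<mu> r \<pi>' \<le> markov_return H P \<mu> r \<pi>"
  shows "CR H H P \<mu> r = eratio (markov_return H P \<mu> r \<pi>) (star_return H P \<mu> r)"
proof (rule antisym)
  let ?J = "markov_return H P \<mu> r \<pi>" and ?U = "star_return H P \<mu> r"
  have J: "0 \<le> ?J" and JU: "?J \<le> ?U"
    using markov_return_nonneg markov_return_le_star r by metis+
  show "eratio ?J ?U \<le> CR H H P \<mu> r"
    unfolding CR_def
  proof (rule INF_greatest)
    fix D assume "D \<in> {D. reward_dists H r D}"
    then have D: "reward_dists H r D" by simp
    \<comment> \<open>With \<open>0 \<le> ?J\<close>, this sandwich makes \<open>?U = 0\<close>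
      force a zero lookahead value, so both ratios are infinite together.\<close>
    have "opt_value H H P \<mu> D \<le> ?U" "?J \<le> opt_value H H P \<mu> D"
      by (rule opt_value_le_star[OF D], rule markov_return_le_opt_value[OF D])
    moreover have "opt_value H 0 P \<mu> D = ?J"
      by (rule opt_value_0[OF D max])
    ultimately show "eratio ?J ?U \<le> eratio (opt_value H 0 P \<mu> D) (opt_value H H P \<mu> D)"
      using J by (auto simp: eratio_def intro!: divide_left_mono mult_pos_pos)
  qed
  show "CR H H P \<mu> r \<le> eratio ?J ?U"
  proof (cases "?U = 0")
    case False
    then have U: "0 < ?U" using J JU by linarith
    have le: "CR H H P \<mu> r \<le> ereal (?J / ((1 - \<epsilon>) ^ H * ?U))" if \<epsilon>: "0 < \<epsilon>" "\<epsilon> < 1" for \<epsilon>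
    proof -
      have D: "reward_dists H r (long_shot \<epsilon> r)"
        using \<epsilon> r by (intro reward_dists_long_shot) auto
      have V: "(1 - \<epsilon>) ^ H * ?U \<le> opt_value H H P \<mu> (long_shot \<epsilon> r)"
        using \<epsilon> r by (intro opt_value_long_shot_ge) auto
      have pos: "0 < (1 - \<epsilon>) ^ H * ?U" using \<epsilon> U by simp
      have "CR H H P \<mu> r \<le> eratio (opt_value H 0 P \<mu> (long_shot \<epsilon> r)) (opt_value H H P \<mu> (long_shot \<epsilon> r))"
        unfolding CR_def using D by (intro INF_lower) simp
      also have "\<dots> \<le> ereal (?J / ((1 - \<epsilon>) ^ H * ?U))"
        using V pos J opt_value_0[OF D max] by (auto simp: eratio_def intro!: divide_left_mono)
      finally show ?thesis .
    qed
    have "((\<lambda>\<epsilon>. ?J / ((1 - \<epsilon>) ^ H * ?U)) \<longlongrightarrow> ?J / ((1 - 0) ^ H * ?U)) (at_right 0)"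
      using U by (intro tendsto_intros) auto
    then have "((\<lambda>\<epsilon>. ereal (?J / ((1 - \<epsilon>) ^ H * ?U))) \<longlongrightarrow> ereal (?J / ?U)) (at_right 0)"
      by simp
    moreover have "eventually (\<lambda>\<epsilon>. CR H H P \<mu> r \<le> ereal (?J / ((1 - \<epsilon>) ^ H * ?U))) (at_right 0)"
      using le by (auto simp: eventually_at_right_field intro!: exI[of _ "1::real"])
    ultimately have "CR H H P \<mu> r \<le> ereal (?J / ?U)"
      by (rule tendsto_lowerbound) simp
    with False show ?thesis by (simp add: eratio_def)
  qed (simp add: eratio_def)
qed

section \<open>Worst-case reward expectations\<close>

text \<open>If no point of \<open>K\<close> makes \<open>u\<close> and \<open>v\<close> positive simultaneously, then mixing \<open>x\<close> and \<open>y\<close>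
  with weights proportional to \<open>v y - u y\<close> and \<open>u x - v x\<close> shows \<open>u x * v y \<le> u y * v x\<close>.\<close>

lemma convexlike_alternative_pair:
  fixes u v :: "'p \<Rightarrow> real"
  assumes cvx: "\<And>x y t. x \<in> K \<Longrightarrow> y \<in> K \<Longrightarrow> 0 \<le> t \<Longrightarrow> t \<le> 1 \<Longrightarrow>
      \<exists>z\<in>K. u z = (1 - t) * u x + t * u y \<and> v z = (1 - t) * v x + t * v y"
    and neg: "\<And>x. x \<in> K \<Longrightarrow> u x \<le> 0 \<or> v x \<le> 0"
  shows "\<exists>t. 0 \<le> t \<and> t \<le> 1 \<and> (\<forall>x\<in>K. (1 - t) * u x + t * v x \<le> 0)"
proof (cases "(\<forall>x\<in>K. u x \<le> 0) \<or> (\<forall>x\<in>K. v x \<le> 0)")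
  case True
  then show ?thesis
  proof
    assume "\<forall>x\<in>K. u x \<le> 0"
    then show ?thesis by (intro exI[of _ 0]) auto
  next
    assume "\<forall>x\<in>K. v x \<le> 0"
    then show ?thesis by (intro exI[of _ 1]) auto
  qed
next
  case False
  then obtain x0 y0 where x0: "x0 \<in> K" "0 < u x0" and y0: "y0 \<in> K" "0 < v y0"
    by (auto simp: not_le)
  have cross: "u x * v y \<le> u y * v x" if xy: "x \<in> K" "0 < u x" "y \<in> K" "0 < v y" for x y
  proof (rule ccontr)
    assume "\<not> ?thesis"
    then have *: "0 < u x * v y - u y * v x" by simp
    define \<alpha> \<beta> where "\<alpha> = v y - u y" and "\<beta> = u x - v x"
    have "v x \<le> 0" "u y \<le> 0" using neg[of x] neg[of y] xy by auto
    with xy have pos: "0 < \<alpha>" "0 < \<beta>" by (auto simp: \<alpha>_def \<beta>_def)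
    \<comment> \<open>This weight makes \<open>u z\<close> and \<open>v z\<close> equal; their
      common value is positive under the assumed failure of the inequality.\<close>
    define t where "t = \<beta> / (\<alpha> + \<beta>)"
    have t: "0 \<le> t" "t \<le> 1" "1 - t = \<alpha> / (\<alpha> + \<beta>)"
      using pos by (auto simp: t_def field_simps)
    obtain z where z: "z \<in> K" "u z = (1 - t) * u x + t * u y" "v z = (1 - t) * v x + t * v y"
      using cvx[OF xy(1,3) t(1,2)] by blast
    have "u z = (u x * v y - u y * v x) / (\<alpha> + \<beta>)" "v z = (u x * v y - u y * v x) / (\<alpha> + \<beta>)"
      unfolding z t(3) unfolding t_def
      by (simp_all add: \<alpha>_def \<beta>_def algebra_simps flip: add_divide_distrib diff_divide_distrib)
    moreover have "0 < (u x * v y - u y * v x) / (\<alpha> + \<beta>)"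
      using * pos by (intro divide_pos_pos) auto
    ultimately show False using neg[OF z(1)] by auto
  qed
  \<comment> \<open>Comparison with the fixed \<open>y0\<close> turns \<open>v x \<le> 0\<close>
    into a strict inequality, so that division by \<open>- v x\<close> is possible.\<close>
  have v_neg: "v x < 0" if "x \<in> K" "0 < u x" for x
  proof -
    have "0 < u y0 * v x"
      using cross[OF that y0] that y0 mult_pos_pos[of "u x" "v y0"] by linarith
    moreover have "u y0 \<le> 0" using neg[OF y0(1)] y0 by auto
    ultimately show ?thesis by (auto simp: zero_less_mult_iff)
  qed
  \<comment> \<open>A multiplier \<open>l\<close> with \<open>u + l * v \<le> 0\<close> must lie
    above every quotient in \<open>A\<close> and below every \<open>- u y / v y\<close> with
    \<open>0 < v y\<close>. The cross inequality says that these demands are compatible, so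
    \<open>Sup A\<close> works; \<open>t\<close> later normalises the weights \<open>1\<close> and
    \<open>l\<close>.\<close>
  define A where "A = {u x / (- v x) | x. x \<in> K \<and> 0 < u x}"
  have le: "q \<le> - u y / v y" if "q \<in> A" "y \<in> K" "0 < v y" for q y
  proof -
    from that obtain x where x: "q = u x / (- v x)" "x \<in> K" "0 < u x" by (auto simp: A_def)
    show ?thesis
      using cross[OF x(2,3) that(2,3)] v_neg[OF x(2,3)] that(3) by (simp add: x field_simps)
  qed
  have bdd: "bdd_above A" using le[OF _ y0] by (rule bdd_aboveI)
  have A_ne: "u x0 / (- v x0) \<in> A" using x0 by (auto simp: A_def)
  define l where "l = Sup A"
  have "0 \<le> u x0 / (- v x0)" using x0 v_neg[OF x0] by (intro divide_nonneg_nonneg) auto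
  also have "\<dots> \<le> l" unfolding l_def by (rule cSup_upper[OF A_ne bdd])
  finally have l: "0 \<le> l" .
  have ul: "u x + l * v x \<le> 0" if x: "x \<in> K" for x
  proof -
    consider "0 < u x" | "0 < v x" | "u x \<le> 0" "v x \<le> 0" by linarith
    then show ?thesis
    proof cases
      case 1
      then have "u x / (- v x) \<le> l"
        unfolding l_def using x by (intro cSup_upper bdd) (auto simp: A_def)
      then show ?thesis using v_neg[OF x 1] by (simp add: field_simps)
    next
      case 2
      have "l \<le> - u x / v x"
        unfolding l_def using A_ne le[OF _ x 2] by (intro cSup_least) auto
      then show ?thesis using 2 by (simp add: field_simps)
    next
      case 3
      then show ?thesis using l mult_nonneg_nonpos[of l "v x"] by linarith
    qed
  qed
  define t where "t = l / (1 + l)"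
  have t: "0 \<le> t" "t \<le> 1" "1 - t = 1 / (1 + l)"
    using l by (auto simp: t_def field_simps)
  have "(1 - t) * u x + t * v x = (u x + l * v x) / (1 + l)" for x
    unfolding t(3) by (simp add: t_def add_divide_distrib)
  with ul l t show ?thesis by (intro exI[of _ t]) (auto simp: divide_nonpos_pos)
qed

text \<open>Where \<open>f k\<close> is positive, one of the other functions must be nonpositive,
  and this region is again closed under mixing. The induction hypothesis on it merges the others
  into one function \<open>g\<close>, and the case of two functions applies to \<open>f k\<close>
  and \<open>g\<close>.\<close>

lemma convexlike_alternative:
  fixes f :: "'i \<Rightarrow> 'p \<Rightarrow> real"
  assumes "finite I" "I \<noteq> {}"
    and cvx: "\<And>x y t. x \<in> K \<Longrightarrow> y \<in> K \<Longrightarrow> 0 \<le> t \<Longrightarrow> t \<le> 1 \<Longrightarrow>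
      \<exists>z\<in>K. \<forall>i\<in>I. f i z = (1 - t) * f i x + t * f i y"
    and neg: "\<And>x. x \<in> K \<Longrightarrow> \<exists>i\<in>I. f i x \<le> 0"
  shows "\<exists>p. (\<forall>i\<in>I. 0 \<le> p i) \<and> (\<Sum>i\<in>I. p i) = 1 \<and> (\<forall>x\<in>K. (\<Sum>i\<in>I. p i * f i x) \<le> 0)"
  using assms
proof (induction I arbitrary: K rule: finite_ne_induct)
  case (singleton i)
  then show ?case by (intro exI[of _ "\<lambda>_. 1"]) auto
next
  case (insert k I)
  define K' where "K' = {x \<in> K. 0 < f k x}"
  have "\<exists>p. (\<forall>i\<in>I. 0 \<le> p i) \<and> (\<Sum>i\<in>I. p i) = 1 \<and> (\<forall>x\<in>K'. (\<Sum>i\<in>I. p i * f i x) \<le> 0)"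
  proof (rule insert.IH)
    fix x y and t :: real assume xy: "x \<in> K'" "y \<in> K'" and t: "0 \<le> t" "t \<le> 1"
    then obtain z where z: "z \<in> K" "\<forall>i\<in>insert k I. f i z = (1 - t) * f i x + t * f i y"
      using insert.prems(1)[of x y t] by (auto simp: K'_def)
    \<comment> \<open>Strictness has to survive mixing so that \<open>z\<close> stays in
      \<open>K'\<close>.\<close>
    moreover have "0 < (1 - t) * f k x + t * f k y"
      using xy t by (cases "t = 0") (auto simp: K'_def intro!: add_nonneg_pos)
    ultimately show "\<exists>z\<in>K'. \<forall>i\<in>I. f i z = (1 - t) * f i x + t * f i y"
      by (intro bexI[of _ z]) (auto simp: K'_def)
  next
    fix x assume "x \<in> K'"
    then show "\<exists>i\<in>I. f i x \<le> 0"
      using insert.prems(2)[of x] by (auto simp: K'_def)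
  qed
  then obtain p where p: "\<And>i. i \<in> I \<Longrightarrow> 0 \<le> p i" "(\<Sum>i\<in>I. p i) = 1"
    and pK: "\<And>x. x \<in> K' \<Longrightarrow> (\<Sum>i\<in>I. p i * f i x) \<le> 0" by blast
  define g where "g x = (\<Sum>i\<in>I. p i * f i x)" for x
  have "\<exists>t. 0 \<le> t \<and> t \<le> 1 \<and> (\<forall>x\<in>K. (1 - t) * f k x + t * g x \<le> 0)"
  proof (rule convexlike_alternative_pair)
    fix x y and t :: real assume "x \<in> K" "y \<in> K" "0 \<le> t" "t \<le> 1"
    then obtain z where z: "z \<in> K" "\<forall>i\<in>insert k I. f i z = (1 - t) * f i x + t * f i y"
      using insert.prems(1) by blast
    moreover have "g z = (1 - t) * g x + t * g y"
      unfolding g_def sum_distrib_left sum.distrib[symmetric]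
      by (intro sum.cong refl) (simp add: z(2) algebra_simps)
    ultimately show "\<exists>z\<in>K. f k z = (1 - t) * f k x + t * f k y \<and> g z = (1 - t) * g x + t * g y"
      by auto
  next
    fix x assume "x \<in> K"
    then show "f k x \<le> 0 \<or> g x \<le> 0"
      using pK[of x] by (cases "0 < f k x") (simp_all add: K'_def g_def)
  qed
  then obtain t where t: "0 \<le> t" "t \<le> 1" "\<And>x. x \<in> K \<Longrightarrow> (1 - t) * f k x + t * g x \<le> 0" by blast
  define q where "q i = (if i = k then 1 - t else t * p i)" for i
  have q: "(\<Sum>i\<in>insert k I. q i * c i) = (1 - t) * c k + t * (\<Sum>i\<in>I. p i * c i)" for c
  proof -
    have "(\<Sum>i\<in>I. q i * c i) = (\<Sum>i\<in>I. t * (p i * c i))"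
      using insert.hyps by (intro sum.cong) (auto simp: q_def)
    then show ?thesis
      using insert.hyps by (simp add: q_def sum_distrib_left)
  qed
  show ?case
  proof (intro exI[of _ q] conjI ballI)
    show "0 \<le> q i" if "i \<in> insert k I" for i
      using that t p by (auto simp: q_def)
    show "(\<Sum>i\<in>insert k I. q i) = 1"
      using q[of "\<lambda>_. 1"] p by simp
    show "(\<Sum>i\<in>insert k I. q i * f i x) \<le> 0" if "x \<in> K" for x
      using q[of "\<lambda>i. f i x"] t(3)[OF that] by (simp add: g_def)
  qed
qed

section \<open>The max-min ratio and its dual weights\<close>

lemma continuous_on_Min_family:
  fixes f :: "'i \<Rightarrow> 'b::topological_space \<Rightarrow> real"
  assumes "finite I" "I \<noteq> {}" "\<And>i. i \<in> I \<Longrightarrow> continuous_on S (f i)"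
  shows "continuous_on S (\<lambda>x. Min ((\<lambda>i. f i x) ` I))"
  using assms
proof (induction I rule: finite_ne_induct)
  case (insert i I)
  then have "continuous_on S (\<lambda>x. min (f i x) (Min ((\<lambda>i. f i x) ` I)))"
    by (intro continuous_on_min) auto
  with insert show ?case by simp
qed simp

text \<open>Indices with \<open>u i = 0\<close> contribute infinity and never decide the minimum
  once some \<open>u i\<close> is positive. Removing them leaves a real minimum, to which continuity
  arguments apply.\<close>

lemma Min_eratio_eq:
  assumes "finite I" "\<And>i. i \<in> I \<Longrightarrow> 0 \<le> u i" "\<exists>i\<in>I. 0 < u i"
  shows "Min ((\<lambda>i. eratio (g i) (u i)) ` I) = ereal (Min ((\<lambda>i. g i / u i) ` {i \<in> I. 0 < u i}))"
proof -
  let ?J = "{i \<in> I. 0 < u i}"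
  have J: "finite ?J" "?J \<noteq> {}" using assms by auto
  have "Min ((\<lambda>i. g i / u i) ` ?J) \<in> (\<lambda>i. g i / u i) ` ?J"
    using J by (intro Min_in) auto
  then obtain j where j: "j \<in> ?J" "Min ((\<lambda>i. g i / u i) ` ?J) = g j / u j" by blast
  show ?thesis
  proof (rule Min_eqI)
    show "ereal (Min ((\<lambda>i. g i / u i) ` ?J)) \<in> (\<lambda>i. eratio (g i) (u i)) ` I"
      using j by (auto simp: eratio_def intro!: image_eqI[of _ _ j])
    show "ereal (Min ((\<lambda>i. g i / u i) ` ?J)) \<le> y" if y: "y \<in> (\<lambda>i. eratio (g i) (u i)) ` I" for y
    proof -
      from y obtain i where i: "i \<in> I" "y = eratio (g i) (u i)" by blast
      show ?thesis
      proof (cases "u i = 0")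
        case False
        then have "i \<in> ?J" using i assms(2)[of i] by auto
        then show ?thesis using i J False by (auto simp: eratio_def)
      qed (simp add: i eratio_def)
    qed
  qed (use assms in auto)
qed

text \<open>This is a saddle point: \<open>\<pi>\<close> guarantees its minimum ratio against all
  nonnegative weights, and \<open>w\<close> certifies that no policy does better. The functionals
  \<open>G\<close> stay abstract so that single coordinates and sums over time are treated at
  once.\<close>

lemma max_min_occupancy_ratio:
  fixes P :: "nat \<Rightarrow> 's::finite \<Rightarrow> 'a::finite \<Rightarrow> 's pmf" and \<mu> :: "'s pmf"
    and G :: "(nat \<Rightarrow> 's \<Rightarrow> 'a \<Rightarrow> real) \<Rightarrow> 'i \<Rightarrow> real" and u :: "'i \<Rightarrow> real"
  assumes I: "finite I" "\<exists>i\<in>I. 0 < u i" and u: "\<And>i. i \<in> I \<Longrightarrow> 0 \<le> u i"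
    and cont: "\<And>i. continuous_on UNIV (\<lambda>d. G d i)"
    and lin: "\<forall>d d1 d2 t i. (\<forall>h s a. d h s a = (1 - t) * d1 h s a + t * d2 h s a) \<longrightarrow>
        G d i = (1 - t) * G d1 i + t * G d2 i"
    and nonneg: "\<And>\<pi> i. 0 \<le> G (occ_sa \<mu> P \<pi>) i"
  defines "m \<pi> \<equiv> Min ((\<lambda>i. eratio (G (occ_sa \<mu> P \<pi>) i) (u i)) ` I)"
  obtains \<pi> w where
    "\<forall>\<pi>'. m \<pi>' \<le> m \<pi>"
    "\<forall>v. (\<forall>i\<in>I. 0 \<le> v i) \<longrightarrow>
        m \<pi> \<le> eratio (\<Sum>i\<in>I. G (occ_sa \<mu> P \<pi>) i * v i) (\<Sum>i\<in>I. u i * v i)"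
    "\<forall>i\<in>I. 0 \<le> w i \<and> w i \<le> 1"
    "\<forall>\<pi>'. eratio (\<Sum>i\<in>I. G (occ_sa \<mu> P \<pi>') i * w i) (\<Sum>i\<in>I. u i * w i) \<le> m \<pi>"
proof -
  define J where "J = {i \<in> I. 0 < u i}"
  have J: "finite J" "J \<noteq> {}" "J \<subseteq> I" using I by (auto simp: J_def)
  define M where "M d = Min ((\<lambda>i. G d i / u i) ` J)" for d
  have m: "m \<pi> = ereal (M (occ_sa \<mu> P \<pi>))" for \<pi>
    unfolding m_def M_def J_def by (rule Min_eratio_eq[OF I(1) u I(2)])
  have "continuous_on UNIV M"
    unfolding M_def using J cont
    by (intro continuous_on_Min_family continuous_on_divide) (auto simp: J_def)
  from occ_sa_attains_max[OF this, of \<mu> P]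
  obtain \<pi> where "\<forall>\<pi>'. M (occ_sa \<mu> P \<pi>') \<le> M (occ_sa \<mu> P \<pi>)" ..
  then have \<pi>: "M (occ_sa \<mu> P \<pi>') \<le> M (occ_sa \<mu> P \<pi>)" for \<pi>' ..
  define c where "c = M (occ_sa \<mu> P \<pi>)"
  have c_le: "c * u i \<le> G (occ_sa \<mu> P \<pi>) i" if "i \<in> J" for i
  proof -
    have "c \<le> G (occ_sa \<mu> P \<pi>) i / u i"
      unfolding c_def M_def using J that by (intro Min_le) auto
    then show ?thesis using that by (simp add: J_def field_simps)
  qed
  have "u i = 0" if "i \<in> I - J" for i
    using u[of i] that by (auto simp: J_def)
  then have u_J: "(\<Sum>i\<in>I. u i * v i) = (\<Sum>i\<in>J. u i * v i)" for v
    using I J by (intro sum.mono_neutral_right) auto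
  \<comment> \<open>Maximality of \<open>\<pi>\<close> means that no policy makes all surpluses
    \<open>G - c * u\<close> positive, which is what the alternative requires.\<close>
  have "\<exists>p. (\<forall>i\<in>J. 0 \<le> p i) \<and> (\<Sum>i\<in>J. p i) = 1
      \<and> (\<forall>\<pi>'\<in>UNIV. (\<Sum>i\<in>J. p i * (G (occ_sa \<mu> P \<pi>') i - c * u i)) \<le> 0)"
  proof (rule convexlike_alternative[OF J(1,2)])
    fix \<pi>1 \<pi>2 and t :: real assume "0 \<le> t" "t \<le> 1"
    from occ_sa_mixture[OF this, of \<mu> P \<pi>1 \<pi>2] obtain \<pi>'
      where "\<And>h s a. occ_sa \<mu> P \<pi>' h s a = (1 - t) * occ_sa \<mu> P \<pi>1 h s a + t * occ_sa \<mu> P \<pi>2 h s a" by blast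
    with lin have "G (occ_sa \<mu> P \<pi>') i = (1 - t) * G (occ_sa \<mu> P \<pi>1) i + t * G (occ_sa \<mu> P \<pi>2) i" for i
      by blast
    then show "\<exists>\<pi>'\<in>UNIV. \<forall>i\<in>J. G (occ_sa \<mu> P \<pi>') i - c * u i
        = (1 - t) * (G (occ_sa \<mu> P \<pi>1) i - c * u i) + t * (G (occ_sa \<mu> P \<pi>2) i - c * u i)"
      by (intro bexI[of _ \<pi>']) (auto simp: algebra_simps)
  next
    fix \<pi>'
    have "M (occ_sa \<mu> P \<pi>') \<in> (\<lambda>i. G (occ_sa \<mu> P \<pi>') i / u i) ` J"
      unfolding M_def using J by (intro Min_in) auto
    then obtain i where i: "i \<in> J" "M (occ_sa \<mu> P \<pi>') = G (occ_sa \<mu> P \<pi>') i / u i" by blast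
    then have "G (occ_sa \<mu> P \<pi>') i / u i \<le> c" using \<pi>[of \<pi>'] by (simp add: c_def)
    with i show "\<exists>i\<in>J. G (occ_sa \<mu> P \<pi>') i - c * u i \<le> 0"
      by (intro bexI[of _ i]) (auto simp: J_def field_simps)
  qed
  then obtain p where p: "\<And>i. i \<in> J \<Longrightarrow> 0 \<le> p i" "(\<Sum>i\<in>J. p i) = 1"
    and p_le: "\<And>\<pi>'. (\<Sum>i\<in>J. p i * (G (occ_sa \<mu> P \<pi>') i - c * u i)) \<le> 0" by blast
  define w where "w i = (if i \<in> J then p i else 0)" for i
  have w_J: "(\<Sum>i\<in>I. y i * w i) = (\<Sum>i\<in>J. y i * p i)" for y
  proof -
    have "(\<Sum>i\<in>I. y i * w i) = (\<Sum>i\<in>J. y i * w i)"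
      using I J by (intro sum.mono_neutral_right) (auto simp: w_def)
    then show ?thesis by (simp add: w_def)
  qed
  \<comment> \<open>The weights sum to 1 on \<open>J\<close>, where \<open>u\<close> is positive, so
    the ratio against \<open>w\<close> does not fall under the infinity convention.\<close>
  have pos: "0 < (\<Sum>i\<in>I. u i * w i)"
  proof -
    have "\<exists>i\<in>J. p i \<noteq> 0"
    proof (rule ccontr)
      assume "\<not> ?thesis"
      then have "(\<Sum>i\<in>J. p i) = 0" by simp
      with p show False by simp
    qed
    then obtain i where i: "i \<in> J" "0 < p i" using p by (metis order.not_eq_order_implies_strict)
    then have "0 < (\<Sum>i\<in>J. u i * p i)"
      using J p by (intro sum_pos2[of _ i]) (auto simp: J_def)
    then show ?thesis by (simp add: w_J)
  qed
  have "m \<pi>' \<le> m \<pi>" for \<pi>'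
    by (simp add: m \<pi>)
  moreover have "0 \<le> w i \<and> w i \<le> 1" if "i \<in> I" for i
    using p member_le_sum[of i J p] J by (auto simp: w_def)
  moreover have "eratio (\<Sum>i\<in>I. G (occ_sa \<mu> P \<pi>') i * w i) (\<Sum>i\<in>I. u i * w i) \<le> m \<pi>" for \<pi>'
  proof -
    have "(\<Sum>i\<in>I. G (occ_sa \<mu> P \<pi>') i * w i) \<le> c * (\<Sum>i\<in>I. u i * w i)"
      using p_le[of \<pi>'] unfolding w_J
      by (simp add: right_diff_distrib sum_subtractf sum_distrib_left mult_ac)
    then show ?thesis
      using pos by (simp add: m eratio_def pos_divide_le_eq flip: c_def)
  qed
  moreover have "m \<pi> \<le> eratio (\<Sum>i\<in>I. G (occ_sa \<mu> P \<pi>) i * v i) (\<Sum>i\<in>I. u i * v i)"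
    if v: "\<forall>i\<in>I. 0 \<le> v i" for v
  proof (cases "(\<Sum>i\<in>I. u i * v i) = 0")
    case False
    have "0 \<le> (\<Sum>i\<in>I. u i * v i)" using u v by (intro sum_nonneg) auto
    with False have pos: "0 < (\<Sum>i\<in>I. u i * v i)" by linarith
    have "c * (\<Sum>i\<in>I. u i * v i) = (\<Sum>i\<in>J. (c * u i) * v i)"
      by (simp add: u_J sum_distrib_left mult_ac)
    also have "\<dots> \<le> (\<Sum>i\<in>J. G (occ_sa \<mu> P \<pi>) i * v i)"
      using J v by (intro sum_mono mult_right_mono c_le) auto
    \<comment> \<open>Outside \<open>J\<close> the denominator receives nothing, while the numerator
      can only grow.\<close>
    also have "\<dots> \<le> (\<Sum>i\<in>I. G (occ_sa \<mu> P \<pi>) i * v i)"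
      using I J v nonneg by (intro sum_mono2) auto
    finally show ?thesis
      using pos by (simp add: m eratio_def pos_le_divide_eq flip: c_def)
  qed (simp add: eratio_def)
  ultimately show thesis
    by (intro that[of \<pi> w] allI ballI impI)
qed

lemma markov_return_as_sum:
  "markov_return H P \<mu> r \<pi> = (\<Sum>(h, s, a)\<in>{0..<H} \<times> UNIV \<times> UNIV. occ_sa \<mu> P \<pi> h s a * r h s a)"
  by (simp add: markov_return_def sum.cartesian_product lessThan_atLeast0)

lemma star_return_as_sum:
  "star_return H P \<mu> r = (\<Sum>(h, s, a)\<in>{0..<H} \<times> UNIV \<times> UNIV. occ_star \<mu> P h s * r h s a)"
  by (simp add: star_return_def sum.cartesian_product lessThan_atLeast0)

lemma markov_return_stat_as_sum:
  "markov_return H P \<mu> (\<lambda>_. r) \<pi> = (\<Sum>(s, a)\<in>UNIV \<times> UNIV. (\<Sum>h<H. occ_sa \<mu> P \<pi> h s a) * r s a)"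
proof -
  have "markov_return H P \<mu> (\<lambda>_. r) \<pi> = (\<Sum>h<H. \<Sum>x\<in>UNIV \<times> UNIV. occ_sa \<mu> P \<pi> h (fst x) (snd x) * r (fst x) (snd x))"
    by (simp add: markov_return_def sum.cartesian_product case_prod_unfold)
  also have "\<dots> = (\<Sum>x\<in>UNIV \<times> UNIV. \<Sum>h<H. occ_sa \<mu> P \<pi> h (fst x) (snd x) * r (fst x) (snd x))"
    by (rule sum.swap)
  finally show ?thesis
    by (simp add: sum_distrib_right case_prod_unfold)
qed

lemma star_return_stat_as_sum:
  "star_return H P \<mu> (\<lambda>_. r) = (\<Sum>(s, a)\<in>UNIV \<times> UNIV. (\<Sum>h<H. occ_star \<mu> P h s) * r s a)"
proof -
  have "star_return H P \<mu> (\<lambda>_. r) = (\<Sum>h<H. \<Sum>x\<in>UNIV \<times> UNIV. occ_star \<mu> P h (fst x) * r (fst x) (snd x))"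
    by (simp add: star_return_def sum.cartesian_product case_prod_unfold)
  also have "\<dots> = (\<Sum>x\<in>UNIV \<times> UNIV. \<Sum>h<H. occ_star \<mu> P h (fst x) * r (fst x) (snd x))"
    by (rule sum.swap)
  finally show ?thesis
    by (simp add: sum_distrib_right case_prod_unfold)
qed

lemma CR_attained:
  fixes P :: "nat \<Rightarrow> 's::finite \<Rightarrow> 'a::finite \<Rightarrow> 's pmf"
  assumes "\<And>h s a. h < H \<Longrightarrow> 0 \<le> r h s a"
  obtains \<pi> where "\<forall>\<pi>'. markov_return H P \<mu> r \<pi>' \<le> markov_return H P \<mu> r \<pi>"
    and "CR H H P \<mu> r = eratio (markov_return H P \<mu> r \<pi>) (star_return H P \<mu> r)"
proof -
  obtain \<pi> where max: "\<forall>\<pi>'. markov_return H P \<mu> r \<pi>' \<le> markov_return H P \<mu> r \<pi>"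
    using markov_return_attains_max[of H P \<mu> r] ..
  then show thesis
    by (intro that[OF max] CR_eq_eratio[OF assms]) auto
qed

text \<open>Every single policy certifies a lower bound, because the ratio is monotone in its
  numerator.\<close>

lemma eratio_le_CR:
  assumes "\<And>h s a. h < H \<Longrightarrow> 0 \<le> r h s a"
  shows "eratio (markov_return H P \<mu> r \<pi>) (star_return H P \<mu> r) \<le> CR H H P \<mu> r"
proof -
  obtain \<pi>0 where "\<forall>\<pi>'. markov_return H P \<mu> r \<pi>' \<le> markov_return H P \<mu> r \<pi>0"
    and eq: "CR H H P \<mu> r = eratio (markov_return H P \<mu> r \<pi>0) (star_return H P \<mu> r)"
    by (rule CR_attained[OF assms])
  then show ?thesis
    unfolding eq by (intro eratio_mono star_return_nonneg assms) auto
qed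

text \<open>The functionals are the coordinates of the occupancy. The dual weights lie in [0, 1],
  hence they are admissible means; \<open>H \<ge> 1\<close> makes the index set nonempty.\<close>

lemma CR_P_eq:
  fixes P :: "nat \<Rightarrow> 's::finite \<Rightarrow> 'a::finite \<Rightarrow> 's pmf" and \<mu> :: "'s pmf"
  assumes "H \<ge> 1"
  defines "m \<pi> \<equiv> Min ((\<lambda>(h, s, a). eratio (occ_sa \<mu> P \<pi> h s a) (occ_star \<mu> P h s)) ` ({0..<H} \<times> UNIV \<times> UNIV))"
  shows "\<exists>\<pi>. CR_P H H P \<mu> = m \<pi> \<and> (\<forall>\<pi>'. m \<pi>' \<le> m \<pi>)"
proof -
  let ?I = "{0..<H} \<times> (UNIV :: 's set) \<times> (UNIV :: 'a set)"
  let ?G = "\<lambda>d :: nat \<Rightarrow> 's \<Rightarrow> 'a \<Rightarrow> real. \<lambda>i. d (fst i) (fst (snd i)) (snd (snd i))"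
  let ?u = "\<lambda>i :: nat \<times> 's \<times> 'a. occ_star \<mu> P (fst i) (fst (snd i))"
  have m: "m \<pi> = Min ((\<lambda>i. eratio (?G (occ_sa \<mu> P \<pi>) i) (?u i)) ` ?I)" for \<pi>
    by (simp add: m_def case_prod_unfold)
  obtain s0 where "0 < occ_star \<mu> P 0 s0"
    using occ_star_pos by blast
  with assms(1) have ex: "\<exists>i\<in>?I. 0 < ?u i"
    by (intro bexI[of _ "(0, s0, undefined)"]) auto
  have fin: "finite ?I" by simp
  have u: "0 \<le> ?u i" for i by (rule occ_star_nonneg)
  have cont: "continuous_on UNIV (\<lambda>d. ?G d i)" for i by (rule continuous_on_coordinate3)
  have lin: "\<forall>d d1 d2 t i. (\<forall>h s a. d h s a = (1 - t) * d1 h s a + t * d2 h s a) \<longrightarrow>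
      ?G d i = (1 - t) * ?G d1 i + t * ?G d2 i"
    by simp
  have nonneg: "0 \<le> ?G (occ_sa \<mu> P \<pi>) i" for \<pi> i by (rule occ_sa_nonneg)
  obtain \<pi> w where opt: "\<forall>\<pi>'. m \<pi>' \<le> m \<pi>"
    and lower: "\<forall>v. (\<forall>i\<in>?I. 0 \<le> v i) \<longrightarrow>
        m \<pi> \<le> eratio (\<Sum>i\<in>?I. ?G (occ_sa \<mu> P \<pi>) i * v i) (\<Sum>i\<in>?I. ?u i * v i)"
    and w: "\<forall>i\<in>?I. 0 \<le> w i \<and> w i \<le> 1"
    and upper: "\<forall>\<pi>'. eratio (\<Sum>i\<in>?I. ?G (occ_sa \<mu> P \<pi>') i * w i) (\<Sum>i\<in>?I. ?u i * w i) \<le> m \<pi>"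
    by (rule max_min_occupancy_ratio[of ?I ?u ?G \<mu> P, folded m, OF fin ex u cont lin nonneg])
  have "CR_P H H P \<mu> = m \<pi>"
  proof (rule antisym)
    let ?r = "\<lambda>h s a. w (h, s, a)"
    have r: "0 \<le> ?r h s a \<and> ?r h s a \<le> 1" if "h < H" for h s a
      using w that by auto
    obtain \<pi>' where "\<forall>\<pi>. markov_return H P \<mu> ?r \<pi> \<le> markov_return H P \<mu> ?r \<pi>'"
      and eq: "CR H H P \<mu> ?r = eratio (markov_return H P \<mu> ?r \<pi>') (star_return H P \<mu> ?r)"
      by (rule CR_attained[OF r[THEN conjunct1]])
    have "CR_P H H P \<mu> \<le> CR H H P \<mu> ?r"
      unfolding CR_P_def using r by (intro INF_lower) auto
    also have "\<dots> \<le> m \<pi>"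
      unfolding eq
      using upper[rule_format, of \<pi>'] by (simp add: markov_return_as_sum star_return_as_sum case_prod_unfold)
    finally show "CR_P H H P \<mu> \<le> m \<pi>" .
    show "m \<pi> \<le> CR_P H H P \<mu>"
      unfolding CR_P_def
    proof (rule INF_greatest)
      fix r :: "nat \<Rightarrow> 's \<Rightarrow> 'a \<Rightarrow> real"
      assume "r \<in> {r. \<forall>h<H. \<forall>s a. 0 \<le> r h s a \<and> r h s a \<le> 1}"
      then have r: "0 \<le> r h s a" if "h < H" for h s a using that by blast
      have "m \<pi> \<le> eratio (markov_return H P \<mu> r \<pi>) (star_return H P \<mu> r)"
        using lower[rule_format, of "\<lambda>i. r (fst i) (fst (snd i)) (snd (snd i))"] r
        by (auto simp: markov_return_as_sum star_return_as_sum case_prod_unfold)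
      also have "\<dots> \<le> CR H H P \<mu> r"
        by (rule eratio_le_CR[OF r])
      finally show "m \<pi> \<le> CR H H P \<mu> r" .
    qed
  qed
  with opt show ?thesis by blast
qed

text \<open>A stationary adversary has one weight per pair \<open>(s, a)\<close>, so the functionals
  become occupancies summed over the steps.\<close>

lemma CR_P_stat_eq:
  fixes P :: "nat \<Rightarrow> 's::finite \<Rightarrow> 'a::finite \<Rightarrow> 's pmf" and \<mu> :: "'s pmf"
  assumes "H \<ge> 1"
  defines "m \<pi> \<equiv> Min ((\<lambda>(s, a). eratio (\<Sum>h<H. occ_sa \<mu> P \<pi> h s a) (\<Sum>h<H. occ_star \<mu> P h s)) ` (UNIV \<times> UNIV))"
  shows "\<exists>\<pi>. CR_P_stat H H P \<mu> = m \<pi> \<and> (\<forall>\<pi>'. m \<pi>' \<le> m \<pi>)"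
proof -
  let ?I = "(UNIV :: 's set) \<times> (UNIV :: 'a set)"
  let ?G = "\<lambda>d :: nat \<Rightarrow> 's \<Rightarrow> 'a \<Rightarrow> real. \<lambda>i. \<Sum>h<H. d h (fst i) (snd i)"
  let ?u = "\<lambda>i :: 's \<times> 'a. \<Sum>h<H. occ_star \<mu> P h (fst i)"
  have m: "m \<pi> = Min ((\<lambda>i. eratio (?G (occ_sa \<mu> P \<pi>) i) (?u i)) ` ?I)" for \<pi>
    by (simp add: m_def case_prod_unfold)
  obtain s0 where "0 < occ_star \<mu> P 0 s0"
    using occ_star_pos by blast
  with assms(1) have "0 < ?u (s0, undefined)"
    by (intro sum_pos2[of _ 0]) (auto simp: occ_star_nonneg)
  then have ex: "\<exists>i\<in>?I. 0 < ?u i" by blast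
  have fin: "finite ?I" by simp
  have u: "0 \<le> ?u i" for i by (intro sum_nonneg occ_star_nonneg)
  have cont: "continuous_on UNIV (\<lambda>d. ?G d i)" for i
    by (intro continuous_on_sum continuous_on_coordinate3)
  have lin: "\<forall>d d1 d2 t i. (\<forall>h s a. d h s a = (1 - t) * d1 h s a + t * d2 h s a) \<longrightarrow>
      ?G d i = (1 - t) * ?G d1 i + t * ?G d2 i"
    by (simp add: sum.distrib sum_distrib_left)
  have nonneg: "0 \<le> ?G (occ_sa \<mu> P \<pi>) i" for \<pi> i
    by (intro sum_nonneg occ_sa_nonneg)
  obtain \<pi> w where opt: "\<forall>\<pi>'. m \<pi>' \<le> m \<pi>"
    and lower: "\<forall>v. (\<forall>i\<in>?I. 0 \<le> v i) \<longrightarrow>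
        m \<pi> \<le> eratio (\<Sum>i\<in>?I. ?G (occ_sa \<mu> P \<pi>) i * v i) (\<Sum>i\<in>?I. ?u i * v i)"
    and w: "\<forall>i\<in>?I. 0 \<le> w i \<and> w i \<le> 1"
    and upper: "\<forall>\<pi>'. eratio (\<Sum>i\<in>?I. ?G (occ_sa \<mu> P \<pi>') i * w i) (\<Sum>i\<in>?I. ?u i * w i) \<le> m \<pi>"
    by (rule max_min_occupancy_ratio[of ?I ?u ?G \<mu> P, folded m, OF fin ex u cont lin nonneg])
  have "CR_P_stat H H P \<mu> = m \<pi>"
  proof (rule antisym)
    let ?r = "\<lambda>s a. w (s, a)"
    have r: "0 \<le> ?r s a \<and> ?r s a \<le> 1" for s a
      using w by auto
    obtain \<pi>' where "\<forall>\<pi>. markov_return H P \<mu> (\<lambda>_. ?r) \<pi> \<le> markov_return H P \<mu> (\<lambda>_. ?r) \<pi>'"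
      and eq: "CR H H P \<mu> (\<lambda>_. ?r)
        = eratio (markov_return H P \<mu> (\<lambda>_. ?r) \<pi>') (star_return H P \<mu> (\<lambda>_. ?r))"
      by (rule CR_attained[OF r[THEN conjunct1]])
    have "CR_P_stat H H P \<mu> \<le> CR H H P \<mu> (\<lambda>_. ?r)"
      unfolding CR_P_stat_def using r by (intro INF_lower) auto
    also have "\<dots> \<le> m \<pi>"
      unfolding eq
      using upper[rule_format, of \<pi>'] by (simp add: markov_return_stat_as_sum star_return_stat_as_sum case_prod_unfold)
    finally show "CR_P_stat H H P \<mu> \<le> m \<pi>" .
    show "m \<pi> \<le> CR_P_stat H H P \<mu>"
      unfolding CR_P_stat_def
    proof (rule INF_greatest)
      fix r :: "'s \<Rightarrow> 'a \<Rightarrow> real"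
      assume "r \<in> {r. \<forall>s a. 0 \<le> r s a \<and> r s a \<le> 1}"
      then have r: "0 \<le> r s a" for s a by blast
      have "m \<pi> \<le> eratio (markov_return H P \<mu> (\<lambda>_. r) \<pi>) (star_return H P \<mu> (\<lambda>_. r))"
        using lower[rule_format, of "\<lambda>i. r (fst i) (snd i)"] r
        by (auto simp: markov_return_stat_as_sum star_return_stat_as_sum case_prod_unfold)
      also have "\<dots> \<le> CR H H P \<mu> (\<lambda>_. r)"
        by (rule eratio_le_CR[OF r])
      finally show "m \<pi> \<le> CR H H P \<mu> (\<lambda>_. r)" .
    qed
  qed
  with opt show ?thesis by blast
qed

section \<open>Lower bounds for all environments\<close>

lemma ereal_le_CR:
  assumes r: "\<And>h s a. h < H \<Longrightarrow> 0 \<le> r h s a"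
    and le: "\<kappa> * star_return H P \<mu> r \<le> markov_return H P \<mu> r \<pi>"
  shows "ereal \<kappa> \<le> CR H H P \<mu> r"
proof -
  have "0 \<le> star_return H P \<mu> r" by (rule star_return_nonneg[OF r])
  then have "ereal \<kappa> \<le> eratio (markov_return H P \<mu> r \<pi>) (star_return H P \<mu> r)"
    using le by (cases "star_return H P \<mu> r = 0") (auto simp: eratio_def pos_le_divide_eq)
  also have "\<dots> \<le> CR H H P \<mu> r" by (rule eratio_le_CR[OF r])
  finally show ?thesis .
qed

text \<open>Each of the \<open>S * A * H\<close> summands of the star return is at most the best
  Markov return, since a policy can commit to that single entry.\<close>

lemma CR_ge_inverse_card:
  fixes P :: "nat \<Rightarrow> 's::finite \<Rightarrow> 'a::finite \<Rightarrow> 's pmf"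
  assumes r: "\<And>h s a. h < H \<Longrightarrow> 0 \<le> r h s a" and H: "H \<ge> 1"
  shows "ereal (1 / (real CARD('s) * real CARD('a) * real H)) \<le> CR H H P \<mu> r"
proof -
  obtain \<pi> where max: "\<forall>\<pi>'. markov_return H P \<mu> r \<pi>' \<le> markov_return H P \<mu> r \<pi>"
    and "CR H H P \<mu> r = eratio (markov_return H P \<mu> r \<pi>) (star_return H P \<mu> r)"
    by (rule CR_attained[OF r])
  have le: "occ_star \<mu> P h s * r h s a \<le> markov_return H P \<mu> r \<pi>" if h: "h < H" for h s a
  proof -
    obtain \<pi>' where "occ_sa \<mu> P \<pi>' h s a = occ_star \<mu> P h s"
      using occ_sa_star_attained by blast
    then have "occ_star \<mu> P h s * r h s a \<le> markov_return H P \<mu> r \<pi>'"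
      using occ_sa_le_markov_return[of H r h \<mu> P \<pi>' s a, OF r h] by simp
    also have "\<dots> \<le> markov_return H P \<mu> r \<pi>" using max by blast
    finally show ?thesis .
  qed
  have "star_return H P \<mu> r \<le> (\<Sum>h<H. \<Sum>s\<in>(UNIV::'s set). \<Sum>a\<in>(UNIV::'a set). markov_return H P \<mu> r \<pi>)"
    unfolding star_return_def by (intro sum_mono le) simp
  also have "\<dots> = real CARD('s) * real CARD('a) * real H * markov_return H P \<mu> r \<pi>"
    by simp
  finally show ?thesis
    using H by (intro ereal_le_CR[OF r, where \<pi> = \<pi>]) (simp_all add: pos_divide_le_eq mult.commute)
qed

definition uniform_policy :: "nat \<Rightarrow> 's \<Rightarrow> 'a::finite pmf" where
  "uniform_policy h s = pmf_of_set UNIV"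

text \<open>Replacing an action law by the uniform one loses a factor of at most
  \<open>CARD('a)\<close> per step.\<close>

lemma occ_le_uniform:
  fixes P :: "nat \<Rightarrow> 's::finite \<Rightarrow> 'a::finite \<Rightarrow> 's pmf"
  shows "occ \<mu> P \<pi> h s \<le> real CARD('a) ^ h * occ \<mu> P uniform_policy h s"
proof (induction h arbitrary: s)
  case (Suc h)
  have "occ \<mu> P \<pi> (Suc h) s
      \<le> (\<Sum>x\<in>UNIV. \<Sum>a\<in>UNIV. (real CARD('a) ^ h * occ \<mu> P uniform_policy h x) * 1 * pmf (P h x a) s)"
    unfolding occ.simps by (intro sum_mono mult_mono Suc) (auto simp: pmf_le_1 occ_nonneg)
  also have "\<dots> = real CARD('a) ^ Suc h * occ \<mu> P uniform_policy (Suc h) s"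
    by (simp add: uniform_policy_def sum_distrib_left mult_ac)
  finally show ?case .
qed simp

lemma CR_ge_inverse_power:
  fixes P :: "nat \<Rightarrow> 's::finite \<Rightarrow> 'a::finite \<Rightarrow> 's pmf"
  assumes r: "\<And>h s a. h < H \<Longrightarrow> 0 \<le> r h s a"
  shows "ereal (1 / real CARD('a) ^ H) \<le> CR H H P \<mu> r"
proof -
  have "occ_star \<mu> P h s \<le> real CARD('a) ^ H * occ_sa \<mu> P uniform_policy h s a" if h: "h < H" for h s and a :: 'a
  proof -
    obtain \<pi> :: "nat \<Rightarrow> 's \<Rightarrow> 'a pmf" where "occ \<mu> P \<pi> h s = occ_star \<mu> P h s"
      using occ_star_attained by blast
    then have "occ_star \<mu> P h s \<le> real CARD('a) ^ h * occ \<mu> P uniform_policy h s"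
      using occ_le_uniform[of \<mu> P \<pi> h s] by simp
    \<comment> \<open>One more factor pays for the action at step \<open>h\<close> itself;
      \<open>Suc h \<le> H\<close> keeps the total within the claim.\<close>
    also have "\<dots> = real CARD('a) ^ Suc h * occ_sa \<mu> P uniform_policy h s a"
      by (simp add: occ_sa_def uniform_policy_def)
    also have "\<dots> \<le> real CARD('a) ^ H * occ_sa \<mu> P uniform_policy h s a"
      using h by (intro mult_right_mono power_increasing occ_sa_nonneg) (auto simp: Suc_le_eq)
    finally show ?thesis .
  qed
  then have "star_return H P \<mu> r
      \<le> (\<Sum>h<H. \<Sum>s\<in>UNIV. \<Sum>a\<in>UNIV. (real CARD('a) ^ H * occ_sa \<mu> P uniform_policy h s a) * r h s a)"
    unfolding star_return_def by (intro sum_mono mult_right_mono r) auto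
  also have "\<dots> = real CARD('a) ^ H * markov_return H P \<mu> r uniform_policy"
    by (simp add: markov_return_def sum_distrib_left mult.assoc)
  finally show ?thesis
    by (intro ereal_le_CR[OF r, where \<pi> = uniform_policy]) (simp_all add: pos_divide_le_eq mult.commute)
qed

section \<open>Hard deterministic environments\<close>

lemma CR_le_ereal:
  assumes r: "\<And>h s a. h < H \<Longrightarrow> 0 \<le> r h s a"
    and "\<And>\<pi>. markov_return H P \<mu> r \<pi> \<le> v" and u: "0 < u" "u \<le> star_return H P \<mu> r"
  shows "CR H H P \<mu> r \<le> ereal (v / u)"
proof -
  obtain \<pi> where "\<forall>\<pi>'. markov_return H P \<mu> r \<pi>' \<le> markov_return H P \<mu> r \<pi>"
    and eq: "CR H H P \<mu> r = eratio (markov_return H P \<mu> r \<pi>) (star_return H P \<mu> r)"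
    by (rule CR_attained[OF r])
  have "0 \<le> markov_return H P \<mu> r \<pi>" by (rule markov_return_nonneg[OF r])
  also have "\<dots> \<le> v" by fact
  finally have "markov_return H P \<mu> r \<pi> / star_return H P \<mu> r \<le> v / u"
    using assms by (intro frac_le) auto
  then show ?thesis using u by (auto simp: eq eratio_def)
qed

text \<open>\<open>CR\<close> depends on the rewards through their means only, so the point mass at
  \<open>\<rho>\<close> serves as the stationary bounded distribution.\<close>

lemma exists_hard_environment:
  fixes p :: "'s::finite \<Rightarrow> 'a::finite \<Rightarrow> 's pmf"
  assumes \<rho>: "\<And>s a. 0 \<le> \<rho> s a \<and> \<rho> s a \<le> 1"
    and le: "CR H H (\<lambda>_. p) \<mu> (\<lambda>_. \<rho>) \<le> x"
  shows "\<exists>(P :: nat \<Rightarrow> 's \<Rightarrow> 'a \<Rightarrow> 's pmf) (\<mu> :: 's pmf) D r.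
     stationary_env H P D \<and> rewards_in_unit H D \<and> reward_dists H r D \<and> CR H H P \<mu> r \<le> x"
proof (intro exI conjI)
  let ?D = "\<lambda>_::nat. measure_pmf (return_pmf \<rho>)"
  show "stationary_env H (\<lambda>_. p) ?D"
    by (simp add: stationary_env_def)
  show "rewards_in_unit H ?D"
    using \<rho> by (simp add: rewards_in_unit_def AE_measure_pmf_iff)
  show "reward_dists H (\<lambda>_. \<rho>) ?D"
    using \<rho> by (auto simp: reward_dists_def AE_measure_pmf_iff prob_space_measure_pmf
        integrable_measure_pmf_finite integral_measure_pmf_real[of "{\<rho>}"])
qed (rule le)

text \<open>A potential argument: \<open>\<Phi>\<close> bounds the reward still to come and drops by
  at least each reward paid. \<open>Good\<close> confines the check to states possible at the given
  step.\<close>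

lemma markov_return_deterministic_le:
  fixes next_state :: "'s::finite \<Rightarrow> 'a::finite \<Rightarrow> 's" and \<rho> \<Phi>
  assumes good: "Good 0 s0" "\<And>h s a. Good h s \<Longrightarrow> Good (Suc h) (next_state s a)"
    and \<Phi>: "\<And>h s a. Good h s \<Longrightarrow> h < H \<Longrightarrow> \<rho> s a + \<Phi> (Suc h) (next_state s a) \<le> \<Phi> h s"
    and \<Phi>_nonneg: "\<And>h s. 0 \<le> \<Phi> h s"
  shows "markov_return H (\<lambda>_ s a. return_pmf (next_state s a)) (return_pmf s0) (\<lambda>_. \<rho>) \<pi> \<le> \<Phi> 0 s0"
proof -
  let ?P = "\<lambda>(_::nat) s a. return_pmf (next_state s a)"
  have sum_return: "(\<Sum>s'\<in>UNIV. pmf (return_pmf y) s' * g s') = g y" for y :: 's and g :: "'s \<Rightarrow> real"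
    by (simp add: pmf_return indicator_def of_bool_def if_distrib[of "\<lambda>x. x * _"] cong: if_cong)
  have "cond_value ?P (\<lambda>h s R. \<pi> h s) (\<lambda>_. \<rho>) k h s \<le> \<Phi> h s" if "Good h s" "h + k = H" for k h s
    using that
  proof (induction k arbitrary: h s)
    case (Suc k)
    have "cond_value ?P (\<lambda>h s R. \<pi> h s) (\<lambda>_. \<rho>) (Suc k) h s \<le> (\<Sum>a\<in>UNIV. pmf (\<pi> h s) a * \<Phi> h s)"
      unfolding cond_value.simps sum_return
    proof (intro sum_mono mult_left_mono)
      fix a
      have "cond_value ?P (\<lambda>h s R. \<pi> h s) (\<lambda>_. \<rho>) k (Suc h) (next_state s a) \<le> \<Phi> (Suc h) (next_state s a)"
        using Suc.prems by (intro Suc.IH good) auto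
      then show "\<rho> s a + cond_value ?P (\<lambda>h s R. \<pi> h s) (\<lambda>_. \<rho>) k (Suc h) (next_state s a) \<le> \<Phi> h s"
        using \<Phi>[of h s a] Suc.prems by auto
    qed simp
    then show ?case by (simp add: sum_pmf_UNIV flip: sum_distrib_right)
  qed (simp add: \<Phi>_nonneg)
  from this[OF good(1), of H] have "cond_value ?P (\<lambda>h s R. \<pi> h s) (\<lambda>_. \<rho>) H 0 s0 \<le> \<Phi> 0 s0" by simp
  then show ?thesis
    using sum_init_cond_value[of "return_pmf s0" ?P "\<lambda>h s R. \<pi> h s" "\<lambda>_. \<rho>" H]
    by (simp add: markov_return_def sum_return)
qed

text \<open>Along a deterministic edge the largest reach probability cannot decrease; reachability
  proofs follow paths in this way.\<close>

lemma occ_star_step: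
  assumes "P h s a = return_pmf s'"
  shows "occ_star \<mu> P h s \<le> occ_star \<mu> P (Suc h) s'"
proof -
  obtain \<pi> where \<pi>: "occ_sa \<mu> P \<pi> h s a = occ_star \<mu> P h s"
    using occ_sa_star_attained by blast
  have "occ_star \<mu> P h s = occ_sa \<mu> P \<pi> h s a * pmf (P h s a) s'"
    by (simp add: \<pi> assms)
  also have "\<dots> \<le> (\<Sum>a\<in>UNIV. occ_sa \<mu> P \<pi> h s a * pmf (P h s a) s')"
    by (rule member_le_sum) (auto simp: occ_sa_nonneg)
  also have "\<dots> \<le> (\<Sum>s\<in>UNIV. \<Sum>a\<in>UNIV. occ_sa \<mu> P \<pi> h s a * pmf (P h s a) s')"
    by (rule member_le_sum[where f = "\<lambda>s. \<Sum>a\<in>UNIV. occ_sa \<mu> P \<pi> h s a * pmf (P h s a) s'"])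
       (auto intro!: sum_nonneg simp: occ_sa_nonneg)
  also have "\<dots> = occ \<mu> P \<pi> (Suc h) s'"
    by (rule occ_Suc[symmetric])
  also have "\<dots> \<le> occ_star \<mu> P (Suc h) s'"
    by (rule occ_le_star)
  finally show ?thesis .
qed

lemma occ_star_0: "1 \<le> occ_star (return_pmf s0) P 0 s0"
  using occ_le_star[of "return_pmf s0" P "\<lambda>h s. return_pmf undefined" 0 s0] by simp

lemma sum_pairs_base:
  fixes e :: "'s::finite \<Rightarrow> nat" and b :: "'a::finite \<Rightarrow> nat" and g :: "nat \<Rightarrow> real"
  assumes e: "bij_betw e UNIV {0..<CARD('s)}" and b: "bij_betw b UNIV {0..<CARD('a)}"
  shows "(\<Sum>s\<in>UNIV. \<Sum>a\<in>UNIV. g (e s * CARD('a) + b a)) = (\<Sum>y<CARD('s) * CARD('a). g y)"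
proof -
  have "(\<Sum>s\<in>UNIV. \<Sum>a\<in>UNIV. g (e s * CARD('a) + b a)) = (\<Sum>s\<in>UNIV. \<Sum>i = 0..<CARD('a). g (e s * CARD('a) + i))"
    by (intro sum.cong refl sum.reindex_bij_betw[OF b])
  also have "\<dots> = (\<Sum>x = 0..<CARD('s). \<Sum>i = 0..<CARD('a). g (x * CARD('a) + i))"
    by (rule sum.reindex_bij_betw[OF e])
  also have "\<dots> = (\<Sum>x<CARD('s). \<Sum>y = x * CARD('a)..<x * CARD('a) + CARD('a). g y)"
  proof -
    have "(\<Sum>i = 0..<CARD('a). g (x * CARD('a) + i)) = (\<Sum>y = x * CARD('a)..<x * CARD('a) + CARD('a). g y)" for x
      using sum.shift_bounds_nat_ivl[of g 0 "x * CARD('a)" "CARD('a)"] by (simp add: add.commute)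
    then show ?thesis by (simp only: lessThan_atLeast0)
  qed
  also have "\<dots> = (\<Sum>y<CARD('s) * CARD('a). g y)"
    by (rule sum.nat_group)
  finally show ?thesis .
qed

lemma sum_of_bool_interval:
  fixes m n k :: nat
  assumes "n \<le> k"
  shows "(\<Sum>y<k. of_bool (m \<le> y \<and> y < n) :: real) = real (n - m)"
proof -
  have "(\<Sum>y<k. of_bool (m \<le> y \<and> y < n) :: real) = (\<Sum>y = m..<n. 1)"
    using assms by (intro sum.mono_neutral_cong_right) auto
  then show ?thesis by simp
qed

lemma finite_type_encoding:
  obtains e :: "'s::finite \<Rightarrow> nat" where "bij_betw e UNIV {0..<CARD('s)}"
  using ex_bij_betw_finite_nat[of "UNIV :: 's set"] by auto

text \<open>The states \<open>x < A ^ n\<close> are base-\<open>A\<close> words with leading zeros dropped, and an action appends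
  a digit.  At the root \<open>0\<close> the digit \<open>0\<close> means waiting, and a word longer than \<open>n\<close>
  digits leads to the absorbing state \<open>A ^ n\<close>, the only rewarded transition.  Every long word
  can be completed at each of the steps \<open>n, \<dots>, H - 1\<close>, but only one of them in an episode.\<close>

lemma hard_waiting_tree:
  assumes A: "2 \<le> CARD('a::finite)" and n: "n < H" and S: "CARD('s::finite) = CARD('a) ^ n + 1"
  shows "\<exists>(p :: 's \<Rightarrow> 'a \<Rightarrow> 's pmf) \<mu> \<rho>. (\<forall>s a. 0 \<le> \<rho> s a \<and> \<rho> s a \<le> 1) \<and>
    CR H H (\<lambda>_. p) \<mu> (\<lambda>_. \<rho>) \<le> ereal (1 / (real (H - n) * (real CARD('a) - 1) * real CARD('a) ^ n))"
proof -
  let ?A = "CARD('a)"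
  obtain e :: "'s \<Rightarrow> nat" where e: "bij_betw e UNIV {0..<CARD('s)}" by (rule finite_type_encoding)
  obtain b :: "'a \<Rightarrow> nat" where b: "bij_betw b UNIV {0..<CARD('a)}" by (rule finite_type_encoding)
  define st where "st = inv e"
  have e_st: "e (st x) = x" if "x \<le> ?A ^ n" for x
    unfolding st_def using that e S by (intro f_inv_into_f) (auto simp: bij_betw_def)
  have st_e: "st (e s) = s" for s
    unfolding st_def using e by (simp add: bij_betw_def)
  have b_surj: "\<exists>a. b a = i" if "i < ?A" for i
    using b that by (metis atLeast0LessThan bij_betw_iff_bijections lessThan_iff)
  \<comment> \<open>Appending a digit is multiplication by \<open>?A\<close> plus the digit; the cap
    \<open>?A ^ n\<close> collects all longer words and maps to itself.\<close>
  define nxt where "nxt s a = st (min (e s * ?A + b a) (?A ^ n))" for s a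
  define \<rho> :: "'s \<Rightarrow> 'a \<Rightarrow> real" where "\<rho> s a = of_bool (?A ^ n \<le> e s * ?A + b a \<and> e s * ?A + b a < ?A ^ Suc n)" for s a
  \<comment> \<open>One unit of reward is available until absorption.\<close>
  define \<Phi> :: "nat \<Rightarrow> 's \<Rightarrow> real" where "\<Phi> h s = of_bool (e s < ?A ^ n)" for h s
  let ?P = "\<lambda>(_::nat) s a. return_pmf (nxt s a)" and ?\<mu> = "return_pmf (st 0)"
  \<comment> \<open>A rewarded transition must start at a proper word, so the absorbing state pays
    nothing.\<close>
  have e_less: "e s < ?A ^ n" if "e s * ?A + b a < ?A ^ Suc n" for s a
  proof -
    have "e s * ?A < ?A ^ n * ?A"
      using le_less_trans[OF le_add1 that] by (simp only: power_Suc mult.commute)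
    then show ?thesis by simp
  qed
  have "\<rho> s a + \<Phi> (Suc h) (nxt s a) \<le> \<Phi> h s" for h s a
  proof -
    have e_nxt: "e (nxt s a) = min (e s * ?A + b a) (?A ^ n)"
      by (simp add: nxt_def e_st)
    have "e s \<le> e s * ?A + b a" by (simp add: trans_le_add1)
    then show ?thesis
      using e_less[of s a] by (auto simp: \<rho>_def \<Phi>_def e_nxt)
  qed
  then have upper: "markov_return H ?P ?\<mu> (\<lambda>_. \<rho>) \<pi> \<le> 1" for \<pi>
    using order_trans[OF markov_return_deterministic_le[of "\<lambda>_ _. True" "st 0" nxt H \<rho> \<Phi> \<pi>], of 1]
    by (auto simp: \<Phi>_def)
  \<comment> \<open>Induction removes the last digit. Numbers with fewer than \<open>h\<close>
    digits are covered too, because their leading zeros are steps of waiting at the root.\<close>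
  have reach: "1 \<le> occ_star ?\<mu> ?P h (st x)" if "x < ?A ^ h" "x < ?A ^ n" for x h
    using that
  proof (induction h arbitrary: x)
    case 0
    then show ?case using occ_star_0 by simp
  next
    case (Suc h)
    have "x div ?A < ?A ^ h"
      using Suc.prems by (simp add: div_less_iff_less_mult mult.commute)
    moreover have le: "x div ?A < ?A ^ n"
      using Suc.prems by (meson div_le_dividend le_less_trans)
    ultimately have "1 \<le> occ_star ?\<mu> ?P h (st (x div ?A))" by (rule Suc.IH)
    also obtain a where a: "b a = x mod ?A" using b_surj[of "x mod ?A"] by auto
    have "nxt (st (x div ?A)) a = st x"
      using Suc.prems le by (simp add: nxt_def e_st a)
    then have "occ_star ?\<mu> ?P h (st (x div ?A)) \<le> occ_star ?\<mu> ?P (Suc h) (st x)"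
      by (intro occ_star_step) simp
    finally show ?case .
  qed
  define U where "U = real (H - n) * (real ?A - 1) * real ?A ^ n"
  \<comment> \<open>There are \<open>?A ^ Suc n - ?A ^ n\<close> rewarded pairs, each available at
    \<open>H - n\<close> different steps.\<close>
  have "U = (\<Sum>h = n..<H. real (?A ^ Suc n - ?A ^ n))"
    by (simp add: U_def of_nat_diff algebra_simps)
  also have "\<dots> = (\<Sum>h = n..<H. \<Sum>s\<in>UNIV. \<Sum>a\<in>UNIV. \<rho> s a)"
    unfolding \<rho>_def
    by (subst sum_pairs_base[OF e b, of "\<lambda>y. of_bool (?A ^ n \<le> y \<and> y < ?A ^ Suc n)"], subst sum_of_bool_interval)
       (simp_all add: S)
  also have "\<dots> \<le> (\<Sum>h = n..<H. \<Sum>s\<in>UNIV. \<Sum>a\<in>UNIV. occ_star ?\<mu> ?P h s * \<rho> s a)"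
  proof (intro sum_mono)
    fix h s a assume h: "h \<in> {n..<H}"
    show "\<rho> s a \<le> occ_star ?\<mu> ?P h s * \<rho> s a"
    proof (cases "\<rho> s a = 0")
      case False
      then have \<rho>: "\<rho> s a = 1" and "e s < ?A ^ n"
        using e_less[of s a] by (auto simp: \<rho>_def split: if_splits)
      moreover have "?A ^ n \<le> ?A ^ h" using h by (intro power_increasing) auto
      ultimately have "1 \<le> occ_star ?\<mu> ?P h (st (e s))" by (intro reach) auto
      then show ?thesis by (simp add: \<rho> st_e)
    qed simp
  qed
  also have "\<dots> \<le> star_return H ?P ?\<mu> (\<lambda>_. \<rho>)"
    unfolding star_return_def
    by (intro sum_mono2 sum_nonneg mult_nonneg_nonneg occ_star_nonneg) (auto simp: \<rho>_def)
  finally have lower: "U \<le> star_return H ?P ?\<mu> (\<lambda>_. \<rho>)" .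
  have "0 < U" using A n by (simp add: U_def)
  with upper lower have "CR H H ?P ?\<mu> (\<lambda>_. \<rho>) \<le> ereal (1 / U)"
    by (intro CR_le_ereal) (auto simp: \<rho>_def)
  then show ?thesis
    unfolding U_def by (intro exI[of _ "\<lambda>s a. return_pmf (nxt s a)"] exI[of _ ?\<mu>] exI[of _ \<rho>]) (auto simp: \<rho>_def)
qed

text \<open>The complete \<open>A\<close>-ary tree of depth \<open>H - 1\<close> in heap numbering, with rewards at the leaves:
  level \<open>h\<close> consists of the numbers from \<open>T h\<close> to \<open>T (Suc h) - 1\<close>.\<close>

lemma hard_full_tree:
  assumes A: "2 \<le> CARD('a::finite)" and H: "1 \<le> H" and S: "CARD('a) ^ H \<le> CARD('s::finite) + 1"
  shows "\<exists>(p :: 's \<Rightarrow> 'a \<Rightarrow> 's pmf) \<mu> \<rho>. (\<forall>s a. 0 \<le> \<rho> s a \<and> \<rho> s a \<le> 1) \<and>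
    CR H H (\<lambda>_. p) \<mu> (\<lambda>_. \<rho>) \<le> ereal (1 / real CARD('a) ^ H)"
proof -
  let ?A = "CARD('a)"
  define T where "T h = (\<Sum>j<h. ?A ^ j)" for h
  have T_0: "T 0 = 0" and T_Suc: "T (Suc h) = ?A * T h + 1" for h
    by (simp_all add: T_def sum.lessThan_Suc_shift sum_distrib_left del: sum.lessThan_Suc)
  have T_Suc': "T (Suc h) = T h + ?A ^ h" for h
    by (simp add: T_def)
  have T_mono: "T h \<le> T k" if "h \<le> k" for h k
    unfolding T_def using that by (intro sum_mono2) auto
  have T_less: "T h < ?A ^ h" for h
  proof (induction h)
    case (Suc h)
    then have "T (Suc h) < 2 * ?A ^ h" by (simp add: T_Suc')
    also have "\<dots> \<le> ?A ^ Suc h" using A by simp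
    finally show ?case .
  qed (simp add: T_0)
  \<comment> \<open>The tree needs \<open>T H\<close> states; the strict bound
    \<open>T H < ?A ^ H\<close> is what makes \<open>?A ^ H - 1\<close> states enough.\<close>
  have T_H: "T H \<le> CARD('s)" using T_less[of H] S by linarith
  obtain K where K: "H = Suc K" using H by (cases H) auto
  obtain e :: "'s \<Rightarrow> nat" where e: "bij_betw e UNIV {0..<CARD('s)}" by (rule finite_type_encoding)
  obtain b :: "'a \<Rightarrow> nat" where b: "bij_betw b UNIV {0..<CARD('a)}" by (rule finite_type_encoding)
  define st where "st = inv e"
  have e_st: "e (st x) = x" if "x < T H" for x
    unfolding st_def using that e T_H by (intro f_inv_into_f) (auto simp: bij_betw_def)
  have st_e: "st (e s) = s" for s
    unfolding st_def using e by (simp add: bij_betw_def)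
  have b_surj: "\<exists>a. b a = i" if "i < ?A" for i
    using b that by (metis atLeast0LessThan bij_betw_iff_bijections lessThan_iff)
  have b_less: "b a < ?A" for a
    using b by (auto simp: bij_betw_def)
  have T_H_pos: "0 < T H" by (simp add: K T_Suc)
  \<comment> \<open>Children beyond the last level are sent back to the root, so leaves and states
    off the tree also have successors.\<close>
  define child where "child x i = (if x * ?A + i + 1 < T H then x * ?A + i + 1 else 0)" for x i
  have child_less: "child x i < T H" for x i using T_H_pos by (simp add: child_def)
  define nxt where "nxt s a = st (child (e s) (b a))" for s a
  define \<rho> :: "'s \<Rightarrow> 'a \<Rightarrow> real" where "\<rho> s a = of_bool (T K \<le> e s \<and> e s < T H)" for s a
  define \<Phi> :: "nat \<Rightarrow> 's \<Rightarrow> real" where "\<Phi> h s = of_bool (h < H)" for h s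
  \<comment> \<open>At step \<open>h\<close> nothing deeper than level \<open>h\<close> has been
    reached, so a leaf can pay only at the last step and a single unit is collected in
    total.\<close>
  define Good where "Good h s \<longleftrightarrow> e s < T (Suc h)" for h s
  let ?P = "\<lambda>(_::nat) s a. return_pmf (nxt s a)" and ?\<mu> = "return_pmf (st 0)"
  have "Good 0 (st 0)"
    using e_st[OF T_H_pos] by (simp add: Good_def T_Suc)
  moreover have "Good (Suc h) (nxt s a)" if "Good h s" for h s a
  proof -
    have "e s + 1 \<le> T (Suc h)" using that by (simp add: Good_def)
    then have "(e s + 1) * ?A \<le> T (Suc h) * ?A" by (rule mult_right_mono) simp
    then have "e s * ?A + b a + 1 < T (Suc (Suc h))"
      using b_less[of a] by (simp add: T_Suc[of "Suc h"] algebra_simps)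
    then show ?thesis
      by (simp add: Good_def nxt_def e_st[OF child_less]) (simp add: child_def T_Suc)
  qed
  moreover have "\<rho> s a + \<Phi> (Suc h) (nxt s a) \<le> \<Phi> h s" if "Good h s" "h < H" for h s a
  proof (cases "Suc h < H")
    case True
    then have "T (Suc h) \<le> T K" using K by (intro T_mono) simp
    with True that show ?thesis by (simp add: \<rho>_def \<Phi>_def Good_def)
  qed (use that in \<open>simp add: \<rho>_def \<Phi>_def\<close>)
  ultimately have upper: "markov_return H ?P ?\<mu> (\<lambda>_. \<rho>) \<pi> \<le> 1" for \<pi>
    using markov_return_deterministic_le[of Good "st 0" nxt H \<rho> \<Phi> \<pi>] H
    by (auto simp: \<Phi>_def)
  have reach: "1 \<le> occ_star ?\<mu> ?P h (st x)" if "T h \<le> x" "x < T (Suc h)" "x < T H" for x h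
    using that
  proof (induction h arbitrary: x)
    case 0
    then show ?case using occ_star_0 by (simp add: T_Suc T_0)
  next
    case (Suc h)
    \<comment> \<open>The parent in heap numbering; the remainder of \<open>x - 1\<close> is the
      action leading to \<open>x\<close>.\<close>
    define y where "y = (x - 1) div ?A"
    have x: "1 \<le> x" "?A * T h \<le> x - 1" "x - 1 < T (Suc h) * ?A"
      using Suc.prems by (auto simp: T_Suc[of h] T_Suc[of "Suc h"] mult.commute)
    have dec: "y * ?A + (x - 1) mod ?A + 1 = x"
      using x by (simp add: y_def)
    have "T h \<le> y"
      using x unfolding y_def by (metis less_eq_div_iff_mult_less_eq mult.commute zero_less_card_finite)
    moreover have "y < T (Suc h)"
      using x unfolding y_def by (simp add: div_less_iff_less_mult)
    moreover have y: "y < T H"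
      using div_le_dividend[of "x - 1" ?A] Suc.prems(3) unfolding y_def by linarith
    ultimately have "1 \<le> occ_star ?\<mu> ?P h (st y)" by (rule Suc.IH)
    also obtain a where a: "b a = (x - 1) mod ?A" using b_surj[of "(x - 1) mod ?A"] by auto
    have "nxt (st y) a = st x"
      using Suc.prems(3) dec by (simp add: nxt_def e_st[OF y] child_def a)
    then have "occ_star ?\<mu> ?P h (st y) \<le> occ_star ?\<mu> ?P (Suc h) (st x)"
      by (intro occ_star_step) simp
    finally show ?case .
  qed
  \<comment> \<open>There are \<open>?A ^ K\<close> leaves with \<open>?A\<close> actions each, all
    counted at the single step \<open>K = H - 1\<close>.\<close>
  have "real ?A ^ H = (\<Sum>s\<in>(UNIV::'s set). \<Sum>a\<in>(UNIV::'a set). \<rho> s a)"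
  proof -
    have "(\<Sum>s\<in>(UNIV::'s set). \<Sum>a\<in>(UNIV::'a set). \<rho> s a)
        = real ?A * (\<Sum>s\<in>UNIV. of_bool (T K \<le> e s \<and> e s < T H))"
      by (simp add: \<rho>_def sum_distrib_left)
    also have "(\<Sum>s\<in>UNIV. of_bool (T K \<le> e s \<and> e s < T H) :: real) = (\<Sum>x<CARD('s). of_bool (T K \<le> x \<and> x < T H))"
      using sum.reindex_bij_betw[OF e, of "\<lambda>x. of_bool (T K \<le> x \<and> x < T H) :: real"]
      by (simp add: lessThan_atLeast0)
    also have "\<dots> = real ?A ^ K"
      by (simp add: sum_of_bool_interval[OF T_H]) (simp add: K T_Suc')
    finally show ?thesis by (simp add: K)
  qed
  also have "\<dots> \<le> (\<Sum>s\<in>(UNIV::'s set). \<Sum>a\<in>(UNIV::'a set). occ_star ?\<mu> ?P K s * \<rho> s a)"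
  proof (intro sum_mono)
    fix s a
    show "\<rho> s a \<le> occ_star ?\<mu> ?P K s * \<rho> s a"
    proof (cases "\<rho> s a = 0")
      case False
      then have \<rho>: "\<rho> s a = 1" and "T K \<le> e s" "e s < T H"
        by (auto simp: \<rho>_def split: if_splits)
      then have "1 \<le> occ_star ?\<mu> ?P K (st (e s))" by (intro reach) (auto simp: K)
      then show ?thesis by (simp add: \<rho> st_e)
    qed simp
  qed
  also have "\<dots> \<le> star_return H ?P ?\<mu> (\<lambda>_. \<rho>)"
    unfolding star_return_def
    by (rule member_le_sum[where f = "\<lambda>h. \<Sum>s\<in>UNIV. \<Sum>a\<in>UNIV. occ_star ?\<mu> ?P h s * \<rho> s a"])
       (auto simp: K \<rho>_def intro!: sum_nonneg mult_nonneg_nonneg occ_star_nonneg)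
  finally have lower: "real ?A ^ H \<le> star_return H ?P ?\<mu> (\<lambda>_. \<rho>)" .
  with upper have "CR H H ?P ?\<mu> (\<lambda>_. \<rho>) \<le> ereal (1 / real ?A ^ H)"
    by (intro CR_le_ereal) (auto simp: \<rho>_def)
  then show ?thesis
    by (intro exI[of _ "\<lambda>s a. return_pmf (nxt s a)"] exI[of _ ?\<mu>] exI[of _ \<rho>]) (auto simp: \<rho>_def)
qed

text \<open>Constant reward 1 has a positive star return, so the ratio is finite. This covers a
  single action, where the claimed bound \<open>1 / A ^ H\<close> equals 1.\<close>

lemma CR_le_1:
  fixes P :: "nat \<Rightarrow> 's::finite \<Rightarrow> 'a::finite \<Rightarrow> 's pmf"
  assumes H: "1 \<le> H"
  shows "CR H H P \<mu> (\<lambda>_ _ _. 1) \<le> ereal 1"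
proof -
  let ?r = "\<lambda>(_::nat) (_::'s) (_::'a). 1 :: real"
  obtain s0 where s0: "0 < occ_star \<mu> P 0 s0" using occ_star_pos by blast
  obtain \<pi> :: "nat \<Rightarrow> 's \<Rightarrow> 'a pmf" where "occ_sa \<mu> P \<pi> 0 s0 undefined = occ_star \<mu> P 0 s0"
    using occ_sa_star_attained by blast
  then have "occ_star \<mu> P 0 s0 \<le> markov_return H P \<mu> ?r \<pi>"
    using occ_sa_le_markov_return[of H ?r 0 \<mu> P \<pi> s0 undefined] H by simp
  also have "\<dots> \<le> star_return H P \<mu> ?r"
    by (rule markov_return_le_star) simp
  finally have pos: "0 < star_return H P \<mu> ?r" using s0 by linarith
  have "CR H H P \<mu> ?r \<le> ereal (star_return H P \<mu> ?r / star_return H P \<mu> ?r)"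
    by (intro CR_le_ereal markov_return_le_star) (simp_all add: pos)
  then show ?thesis using pos by simp
qed

section \<open>Existence of the hard environments in the form of the theorem\<close>

lemma exists_environment_full_tree:
  assumes H: "1 \<le> H" and S: "real CARD('a::finite) ^ H - 1 \<le> real CARD('s::finite)" and \<delta>: "0 < \<delta>"
  shows "\<exists>(P :: nat \<Rightarrow> 's \<Rightarrow> 'a \<Rightarrow> 's pmf) \<mu> D r.
    stationary_env H P D \<and> rewards_in_unit H D \<and> reward_dists H r D \<and>
    CR H H P \<mu> r \<le> ereal ((1 + \<delta>) / real CARD('a) ^ H)"
proof -
  have "\<exists>(p :: 's \<Rightarrow> 'a \<Rightarrow> 's pmf) \<mu> \<rho>. (\<forall>s a. 0 \<le> \<rho> s a \<and> \<rho> s a \<le> 1) \<and>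
    CR H H (\<lambda>_. p) \<mu> (\<lambda>_. \<rho>) \<le> ereal (1 / real CARD('a) ^ H)"
  proof (cases "2 \<le> CARD('a)")
    case True
    have "real (CARD('a) ^ H) \<le> real (CARD('s) + 1)" using S by simp
    then show ?thesis
      using True H by (intro hard_full_tree) (simp_all only: of_nat_le_iff)
  next
    case False
    then have "CARD('a) = 1" using zero_less_card_finite[where 'a = 'a] by linarith
    then have "CR H H (\<lambda>_. p) \<mu> (\<lambda>_ _ _. 1) \<le> ereal (1 / real CARD('a) ^ H)"
      for p :: "'s \<Rightarrow> 'a \<Rightarrow> 's pmf" and \<mu>
      using CR_le_1[OF H, of "\<lambda>_. p" \<mu>] by simp
    then show ?thesis by (intro exI[of _ undefined] exI[of _ "\<lambda>_ _. 1"] conjI) auto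
  qed
  then obtain p :: "'s \<Rightarrow> 'a \<Rightarrow> 's pmf" and \<mu> \<rho> where \<rho>: "\<And>s a. 0 \<le> \<rho> s a \<and> \<rho> s a \<le> 1"
    and le: "CR H H (\<lambda>_. p) \<mu> (\<lambda>_. \<rho>) \<le> ereal (1 / real CARD('a) ^ H)" by blast
  have "ereal (1 / real CARD('a) ^ H) \<le> ereal ((1 + \<delta>) / real CARD('a) ^ H)"
    using \<delta> by (simp add: divide_right_mono)
  with le show ?thesis by (intro exists_hard_environment[OF \<rho>]) (rule order_trans)
qed

lemma exists_environment_waiting_tree:
  assumes n: "n < H" and S: "CARD('s::finite) = CARD('a::finite) ^ n + 1" and A: "2 \<le> CARD('a)" and \<delta>: "0 < \<delta>"
  shows "\<exists>(P :: nat \<Rightarrow> 's \<Rightarrow> 'a \<Rightarrow> 's pmf) \<mu> D r.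
    stationary_env H P D \<and> rewards_in_unit H D \<and> reward_dists H r D \<and>
    CR H H P \<mu> r \<le> ereal ((1 + \<delta>) /
      ((real H - log (real CARD('a)) (real CARD('s) - 1)) * (real CARD('a) - 1) * (real CARD('s) - 1)))"
proof -
  \<comment> \<open>Since \<open>S - 1 = A ^ n\<close>, the logarithm is exactly
    \<open>n\<close>.\<close>
  have eq: "(real H - log (real CARD('a)) (real CARD('s) - 1)) * (real CARD('a) - 1) * (real CARD('s) - 1)
      = real (H - n) * (real CARD('a) - 1) * real CARD('a) ^ n"
    using A n by (simp add: S log_nat_power of_nat_diff)
  obtain p :: "'s \<Rightarrow> 'a \<Rightarrow> 's pmf" and \<mu> \<rho> where \<rho>: "\<And>s a. 0 \<le> \<rho> s a \<and> \<rho> s a \<le> 1"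
    and le: "CR H H (\<lambda>_. p) \<mu> (\<lambda>_. \<rho>) \<le> ereal (1 / (real (H - n) * (real CARD('a) - 1) * real CARD('a) ^ n))"
    using hard_waiting_tree[OF A n S] by blast
  have "ereal (1 / (real (H - n) * (real CARD('a) - 1) * real CARD('a) ^ n))
      \<le> ereal ((1 + \<delta>) / (real (H - n) * (real CARD('a) - 1) * real CARD('a) ^ n))"
    unfolding ereal_less_eq using A \<delta> by (intro divide_right_mono) auto
  with le show ?thesis
    unfolding eq by (intro exists_hard_environment[OF \<rho>]) (rule order_trans)
qed

theorem theorem1:
  fixes H :: nat
  assumes "H \<ge> 1"
  shows
   \<comment> \<open>1. worst-case distributions\<close>
   "(\<forall>(P :: nat \<Rightarrow> 's::finite \<Rightarrow> 'a::finite \<Rightarrow> 's pmf) (\<mu> :: 's pmf) r.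
       (\<forall>h<H. \<forall>s a. 0 \<le> r h s a) \<longrightarrow>
       (\<exists>\<pi>::nat \<Rightarrow> 's \<Rightarrow> 'a pmf.
          CR H H P \<mu> r =
            eratio (\<Sum>h<H. \<Sum>s\<in>UNIV. \<Sum>a\<in>UNIV. occ_sa \<mu> P \<pi> h s a * r h s a)
                   (\<Sum>h<H. \<Sum>s\<in>UNIV. \<Sum>a\<in>UNIV. occ_star \<mu> P h s * r h s a) \<and>
          (\<forall>\<pi>'::nat \<Rightarrow> 's \<Rightarrow> 'a pmf.
             eratio (\<Sum>h<H. \<Sum>s\<in>UNIV. \<Sum>a\<in>UNIV. occ_sa \<mu> P \<pi>' h s a * r h s a)
                    (\<Sum>h<H. \<Sum>s\<in>UNIV. \<Sum>a\<in>UNIV. occ_star \<mu> P h s * r h s a)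
             \<le> eratio (\<Sum>h<H. \<Sum>s\<in>UNIV. \<Sum>a\<in>UNIV. occ_sa \<mu> P \<pi> h s a * r h s a)
                      (\<Sum>h<H. \<Sum>s\<in>UNIV. \<Sum>a\<in>UNIV. occ_star \<mu> P h s * r h s a)))) \<and>
    \<comment> \<open>2. worst-case reward expectations\<close>
    (\<forall>(P :: nat \<Rightarrow> 's \<Rightarrow> 'a \<Rightarrow> 's pmf) (\<mu> :: 's pmf).
       (\<exists>\<pi>::nat \<Rightarrow> 's \<Rightarrow> 'a pmf.
          CR_P H H P \<mu> =
            Min ((\<lambda>(h, s, a). eratio (occ_sa \<mu> P \<pi> h s a) (occ_star \<mu> P h s))
                   ` ({0..<H} \<times> UNIV \<times> UNIV)) \<and>
          (\<forall>\<pi>'::nat \<Rightarrow> 's \<Rightarrow> 'a pmf.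
             Min ((\<lambda>(h, s, a). eratio (occ_sa \<mu> P \<pi>' h s a) (occ_star \<mu> P h s))
                   ` ({0..<H} \<times> UNIV \<times> UNIV))
             \<le> Min ((\<lambda>(h, s, a). eratio (occ_sa \<mu> P \<pi> h s a) (occ_star \<mu> P h s))
                   ` ({0..<H} \<times> UNIV \<times> UNIV))))) \<and>
    (\<forall>(P :: nat \<Rightarrow> 's \<Rightarrow> 'a \<Rightarrow> 's pmf) (\<mu> :: 's pmf).
       (\<exists>\<pi>::nat \<Rightarrow> 's \<Rightarrow> 'a pmf.
          CR_P_stat H H P \<mu> =
            Min ((\<lambda>(s, a). eratio (\<Sum>h<H. occ_sa \<mu> P \<pi> h s a) (\<Sum>h<H. occ_star \<mu> P h s))
                   ` (UNIV \<times> UNIV)) \<and>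
          (\<forall>\<pi>'::nat \<Rightarrow> 's \<Rightarrow> 'a pmf.
             Min ((\<lambda>(s, a). eratio (\<Sum>h<H. occ_sa \<mu> P \<pi>' h s a) (\<Sum>h<H. occ_star \<mu> P h s))
                   ` (UNIV \<times> UNIV))
             \<le> Min ((\<lambda>(s, a). eratio (\<Sum>h<H. occ_sa \<mu> P \<pi> h s a) (\<Sum>h<H. occ_star \<mu> P h s))
                   ` (UNIV \<times> UNIV))))) \<and>
    \<comment> \<open>3. worst-case environments: lower bound\<close>
    (\<forall>(P :: nat \<Rightarrow> 's \<Rightarrow> 'a \<Rightarrow> 's pmf) (\<mu> :: 's pmf) r.
       (\<forall>h<H. \<forall>s a. 0 \<le> r h s a) \<longrightarrow>
       ereal (max (1 / (real CARD('s) * real CARD('a) * real H)) (1 / real CARD('a) ^ H))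
         \<le> CR H H P \<mu> r) \<and>
    \<comment> \<open>3. worst-case environments: upper bounds\<close>
    (\<forall>\<delta>::real. 0 < \<delta> \<and> \<delta> < 1 \<longrightarrow>
       (\<forall>n<H. CARD('s) = CARD('a) ^ n + 1 \<longrightarrow> 2 \<le> CARD('a) \<longrightarrow>
          (\<exists>(P :: nat \<Rightarrow> 's \<Rightarrow> 'a \<Rightarrow> 's pmf) (\<mu> :: 's pmf) D r.
             stationary_env H P D \<and> rewards_in_unit H D \<and> reward_dists H r D \<and>
             CR H H P \<mu> r \<le>
               ereal ((1 + \<delta>) /
                 ((real H - log (real CARD('a)) (real CARD('s) - 1))
                   * (real CARD('a) - 1) * (real CARD('s) - 1))))) \<and>
       (real CARD('s) \<ge> real CARD('a) ^ H - 1 \<longrightarrow>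
          (\<exists>(P :: nat \<Rightarrow> 's \<Rightarrow> 'a \<Rightarrow> 's pmf) (\<mu> :: 's pmf) D r.
             stationary_env H P D \<and> rewards_in_unit H D \<and> reward_dists H r D \<and>
             CR H H P \<mu> r \<le> ereal ((1 + \<delta>) / real CARD('a) ^ H))))"
proof (intro conjI allI impI)
  fix P :: "nat \<Rightarrow> 's \<Rightarrow> 'a \<Rightarrow> 's pmf" and \<mu> :: "'s pmf" and r :: "nat \<Rightarrow> 's \<Rightarrow> 'a \<Rightarrow> real"
  assume "\<forall>h<H. \<forall>s a. 0 \<le> r h s a"
  then have r: "\<And>h s a. h < H \<Longrightarrow> 0 \<le> r h s a" by blast
  obtain \<pi> where "\<forall>\<pi>'. markov_return H P \<mu> r \<pi>' \<le> markov_return H P \<mu> r \<pi>"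
    and "CR H H P \<mu> r = eratio (markov_return H P \<mu> r \<pi>) (star_return H P \<mu> r)"
    by (rule CR_attained[OF r])
  \<comment> \<open>A nonnegative denominator makes \<open>eratio\<close> monotone in its numerator,
    so the maximiser of the return also maximises the ratio.\<close>
  moreover have "0 \<le> star_return H P \<mu> r" by (rule star_return_nonneg[OF r])
  ultimately show "\<exists>\<pi>::nat \<Rightarrow> 's \<Rightarrow> 'a pmf.
          CR H H P \<mu> r =
            eratio (\<Sum>h<H. \<Sum>s\<in>UNIV. \<Sum>a\<in>UNIV. occ_sa \<mu> P \<pi> h s a * r h s a)
                   (\<Sum>h<H. \<Sum>s\<in>UNIV. \<Sum>a\<in>UNIV. occ_star \<mu> P h s * r h s a) \<and>
          (\<forall>\<pi>'::nat \<Rightarrow> 's \<Rightarrow> 'a pmf.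
             eratio (\<Sum>h<H. \<Sum>s\<in>UNIV. \<Sum>a\<in>UNIV. occ_sa \<mu> P \<pi>' h s a * r h s a)
                    (\<Sum>h<H. \<Sum>s\<in>UNIV. \<Sum>a\<in>UNIV. occ_star \<mu> P h s * r h s a)
             \<le> eratio (\<Sum>h<H. \<Sum>s\<in>UNIV. \<Sum>a\<in>UNIV. occ_sa \<mu> P \<pi> h s a * r h s a)
                      (\<Sum>h<H. \<Sum>s\<in>UNIV. \<Sum>a\<in>UNIV. occ_star \<mu> P h s * r h s a))"
    unfolding markov_return_def[symmetric] star_return_def[symmetric]
    by (intro exI[of _ \<pi>] conjI allI eratio_mono) auto
  show "ereal (max (1 / (real CARD('s) * real CARD('a) * real H)) (1 / real CARD('a) ^ H)) \<le> CR H H P \<mu> r"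
    using CR_ge_inverse_card[of H r P \<mu>, OF r assms] CR_ge_inverse_power[of H r P \<mu>, OF r]
    by (simp add: max_def)
qed (rule CR_P_eq[OF assms] CR_P_stat_eq[OF assms]
      exists_environment_waiting_tree exists_environment_full_tree[OF assms]; simp)+

end
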